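(* The variety $\mathcal{NJS}^{(1,4)}$ of nilpotent Jordan superalgebras of type $(1,4)$ over $\mathbb{C}$ has four irreducible components, given by $$\mathcal{C}_1=\overline{O((1,4)_3)},\quad \mathcal{C}_2=\overline{O((1,4)_6)},\quad \mathcal{C}_3=\overline{O((1,4)_7)},\quad \mathcal{C}_4=\overline{O((1,4)_9)},$$ where, on a homogeneous basis $\{e_1\}\cup\{f_1,f_2,f_3,f_4\}$ ($e_1$ even, $f_i$ odd), \begin{itemize} \item $(1,4)_3$: $f_1f_2=e_1,\ f_3f_4=e_1$; \item $(1,4)_6$: $e_1f_2=f_1,\ f_3f_4=e_1$; \item $(1,4)_7$: $e_1f_2=f_1,\ e_1f_3=f_2$; \item $(1,4)_9$: $e_1f_2=f_1,\ e_1f_4=f_3,\ f_2f_4=e_1$. \end{itemize} In particular, up to isomorphism, the rigid superalgebras in $\mathcal{NJS}^{(1,4)}$ are exactly $(1,4)_i$ with $i\in\{3,6,7,9\}$.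
   Context: All vector spaces are over $\mathbb{C}$. A superalgebra $J=J_0\oplus J_1$ is a $\mathbb{Z}_2$-graded (not necessarily associative) algebra: $J_iJ_j\subseteq J_{i+j \bmod 2}$; $|x|=i$ denotes the parity of a nonzero $x\in J_i$. A Jordan superalgebra is a superalgebra satisfying, for all nonzero homogeneous $x,y,z,w$, supercommutativity $xy=(-1)^{|x||y|}yx$ and the Jordan superidentity $$(wx)(yz)+(-1)^{|x||y|}(wy)(xz)+(-1)^{(|x|+|y|)|z|}(wz)(xy)-(-1)^{|w||x|}x(w(yz))-(-1)^{|y|(|w|+|x|)}y(w(xz))-(-1)^{|z|(|w|+|x|+|y|)}z(w(xy))=0.$$ $J$ is of type $(m,n)$ if $\dim J_0=m$ and $\dim J_1=n$. Put $J^1=J$ and $J^{k+1}=J^kJ+J^{k-1}J^2+\cdots+JJ^k$ for $k\ge 1$; $J$ is nilpotent if $J^k=0$ for some $k\geq 1$. Fix a $\mathbb{Z}_2$-graded vector space $V=V_0\oplus V_1$ with homogeneous basis $\{e_1,\dots,e_m\}\cup\{f_1,\dots,f_n\}$. A Jordan superalgebra structure on $V$ is encoded by its structure constants $(c_{ij}^k,\rho_{ij}^k,\Gamma_{ij}^k)\in\mathbb{C}^{m^3+2mn^2}$, where $e_ie_j=\sum_{k=1}^m c_{ij}^ke_k$, $e_if_j=\sum_{k=1}^n\rho_{ij}^kf_k$, $f_if_j=\sum_{k=1}^m\Gamma_{ij}^ke_k$. $\mathcal{NJS}^{(m,n)}\subseteq\mathbb{C}^{m^3+2mn^2}$ is the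 affine variety (Zariski closed set) of all structure constants of nilpotent Jordan superalgebras of type $(m,n)$. The group $G=\mathrm{GL}_m(\mathbb{C})\times\mathrm{GL}_n(\mathbb{C})$ acts on it by change of basis; its orbits are the isomorphism classes (isomorphisms are grading-preserving). $O(J)$ denotes the $G$-orbit of $J$ and the bar denotes Zariski closure. $J\in\mathcal{NJS}^{(m,n)}$ is rigid if $O(J)$ is Zariski open in $\mathcal{NJS}^{(m,n)}$. In multiplication tables, products of basis elements that are neither listed nor obtained from listed ones by supercommutativity ($e_if_j=f_je_i$, $f_if_j=-f_jf_i$, $e_ie_j=e_je_i$) are zero. *)

theory Defs
  imports "HOL-Analysis.Analysis"
begin

section \<open>Graded algebras on a fixed graded space\<close>

text \<open>
  The graded space \<open>V = V\<^sub>0 \<oplus> V\<^sub>1\<close> with its fixed homogeneous basis is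
  \<open>complex ^ ('m + 'n)\<close>, where \<open>m = CARD('m)\<close> and \<open>n = CARD('n)\<close>: the even
  basis vector \<open>e\<^sub>i\<close> is \<open>bvec (Inl i)\<close> and the odd basis vector \<open>f\<^sub>j\<close> is
  \<open>bvec (Inr j)\<close>.
\<close>

type_synonym ('m, 'n) gspace = "complex ^ ('m + 'n)"

type_synonym ('m, 'n) gmult = "('m, 'n) gspace \<Rightarrow> ('m, 'n) gspace \<Rightarrow> ('m, 'n) gspace"

definition bvec :: "'m::finite + 'n::finite \<Rightarrow> ('m, 'n) gspace" where
  "bvec s = axis s 1"

text \<open>The homogeneous part of degree \<open>p\<close>, with \<open>p\<close> read modulo 2.\<close>

definition hpart :: "nat \<Rightarrow> ('m::finite, 'n::finite) gspace set" where
  "hpart p = (if even p then {v. \<forall>j. v $ Inr j = 0} else {v. \<forall>i. v $ Inl i = 0})"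

definition superalgebra :: "('m::finite, 'n::finite) gmult \<Rightarrow> bool" where
  "superalgebra mul \<longleftrightarrow>
     (\<forall>x. Vector_Spaces.linear (*s) (*s) (\<lambda>y. mul x y)) \<and>
     (\<forall>y. Vector_Spaces.linear (*s) (*s) (\<lambda>x. mul x y)) \<and>
     (\<forall>a\<in>{0,1}. \<forall>b\<in>{0,1}. \<forall>x\<in>hpart a. \<forall>y\<in>hpart b. mul x y \<in> hpart (a + b))"

text \<open>
  In both identities below, \<open>a, b, c, d\<close> are the parities of \<open>w, x, y, z\<close>
  respectively. Zero vectors are not excluded; for a bilinear product the identities
  hold trivially there.
\<close>

definition supercommutative :: "('m::finite, 'n::finite) gmult \<Rightarrow> bool" where
  "supercommutative mul \<longleftrightarrow>
     (\<forall>b\<in>{0,1}. \<forall>c\<in>{0,1}. \<forall>x\<in>hpart b. \<forall>y\<in>hpart c. mul x y = (-1) ^ (b * c) *s mul y x)"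

definition jordan_superidentity :: "('m::finite, 'n::finite) gmult \<Rightarrow> bool" where
  "jordan_superidentity mul \<longleftrightarrow>
     (\<forall>a\<in>{0,1}. \<forall>b\<in>{0,1}. \<forall>c\<in>{0,1}. \<forall>d\<in>{0,1}.
      \<forall>w\<in>hpart a. \<forall>x\<in>hpart b. \<forall>y\<in>hpart c. \<forall>z\<in>hpart d.
        mul (mul w x) (mul y z)
        + (-1) ^ (b * c) *s mul (mul w y) (mul x z)
        + (-1) ^ ((b + c) * d) *s mul (mul w z) (mul x y)
        - (-1) ^ (a * b) *s mul x (mul w (mul y z))
        - (-1) ^ (c * (a + b)) *s mul y (mul w (mul x z))
        - (-1) ^ (d * (a + b + c)) *s mul z (mul w (mul x y)) = 0)"

definition jordan_superalgebra :: "('m::finite, 'n::finite) gmult \<Rightarrow> bool" where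
  "jordan_superalgebra mul \<longleftrightarrow>
     superalgebra mul \<and> supercommutative mul \<and> jordan_superidentity mul"

text \<open>
  \<open>alg_power mul k\<close> is \<open>J\<^sup>k\<close> for \<open>k \<ge> 1\<close>, the sum over \<open>i = 1, \<dots>, k - 1\<close> of the
  subspaces \<open>J\<^bsup>k-i\<^esup> J\<^sup>i\<close> (spanned by products) when \<open>k \<ge> 2\<close>. The value at \<open>0\<close> is a
  dummy.
\<close>

function alg_power :: "('m::finite, 'n::finite) gmult \<Rightarrow> nat \<Rightarrow> ('m, 'n) gspace set" where
  "alg_power mul k =
     (if k \<le> 1 then UNIV
      else vec.span (\<Union>i\<in>{1..<k}. (\<lambda>(x, y). mul x y) ` (alg_power mul (k - i) \<times> alg_power mul i)))"
  by pat_completeness auto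
termination
  by (relation "Wellfounded.measure snd") auto

declare alg_power.simps [simp del]

definition nilpotent_alg :: "('m::finite, 'n::finite) gmult \<Rightarrow> bool" where
  "nilpotent_alg mul \<longleftrightarrow> (\<exists>k\<ge>1. alg_power mul k = {0})"

definition superalgebra_iso ::
  "('m::finite, 'n::finite) gmult \<Rightarrow> ('m, 'n) gmult \<Rightarrow> bool" where
  "superalgebra_iso mul mul' \<longleftrightarrow>
     (\<exists>h. Vector_Spaces.linear (*s) (*s) h \<and> bij h \<and>
          (\<forall>p\<in>{0,1}. \<forall>v\<in>hpart p. h v \<in> hpart p) \<and>
          (\<forall>x y. h (mul x y) = mul' (h x) (h y)))"


section \<open>Structure constants\<close>

text \<open>
  A point of \<open>\<complex>\<close> to the power \<open>m\<^sup>3 + 2mn\<^sup>2\<close> collects the structure constants: with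
  \<open>A\<close> such a point, \<open>c\<^sub>i\<^sub>j\<^sup>k = A $ Inl (i, j, k)\<close>,
  \<open>\<rho>\<^sub>i\<^sub>j\<^sup>k = A $ Inr (Inl (i, j, k))\<close> and \<open>\<Gamma>\<^sub>i\<^sub>j\<^sup>k = A $ Inr (Inr (i, j, k))\<close>.
\<close>

type_synonym ('m, 'n) sconst =
  "complex ^ (('m \<times> 'm \<times> 'm) + (('m \<times> 'n \<times> 'n) + ('n \<times> 'n \<times> 'm)))"

text \<open>
  The products \<open>f\<^sub>j e\<^sub>i\<close> are not recorded among the structure constants; they are
  recovered from supercommutativity, \<open>f\<^sub>j e\<^sub>i = e\<^sub>i f\<^sub>j\<close>.
\<close>

fun basis_mult :: "('m::finite, 'n::finite) sconst \<Rightarrow> 'm + 'n \<Rightarrow> 'm + 'n \<Rightarrow> ('m, 'n) gspace" where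
  "basis_mult A (Inl i) (Inl j) = (\<Sum>k\<in>UNIV. A $ Inl (i, j, k) *s bvec (Inl k))"
| "basis_mult A (Inl i) (Inr j) = (\<Sum>k\<in>UNIV. A $ Inr (Inl (i, j, k)) *s bvec (Inr k))"
| "basis_mult A (Inr j) (Inl i) = (\<Sum>k\<in>UNIV. A $ Inr (Inl (i, j, k)) *s bvec (Inr k))"
| "basis_mult A (Inr i) (Inr j) = (\<Sum>k\<in>UNIV. A $ Inr (Inr (i, j, k)) *s bvec (Inl k))"

definition mult_of :: "('m::finite, 'n::finite) sconst \<Rightarrow> ('m, 'n) gmult" where
  "mult_of A x y = (\<Sum>s\<in>UNIV. \<Sum>t\<in>UNIV. (x $ s * y $ t) *s basis_mult A s t)"

definition sconst_of :: "('m::finite, 'n::finite) gmult \<Rightarrow> ('m, 'n) sconst" where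
  "sconst_of mul = (\<chi> s. case s of
       Inl (i, j, k) \<Rightarrow> mul (bvec (Inl i)) (bvec (Inl j)) $ Inl k
     | Inr (Inl (i, j, k)) \<Rightarrow> mul (bvec (Inl i)) (bvec (Inr j)) $ Inr k
     | Inr (Inr (i, j, k)) \<Rightarrow> mul (bvec (Inr i)) (bvec (Inr j)) $ Inl k)"

definition NJS :: "('m::finite, 'n::finite) sconst set" where
  "NJS = {A. jordan_superalgebra (mult_of A) \<and> nilpotent_alg (mult_of A)}"

definition block_map :: "complex ^ 'm ^ 'm \<Rightarrow> complex ^ 'n ^ 'n \<Rightarrow>
    ('m::finite, 'n::finite) gspace \<Rightarrow> ('m, 'n) gspace" where
  "block_map P Q v = (\<chi> s. case s of
       Inl i \<Rightarrow> (P *v (\<chi> i'. v $ Inl i')) $ i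
     | Inr j \<Rightarrow> (Q *v (\<chi> j'. v $ Inr j')) $ j)"

text \<open>The action of \<open>g = (P, Q)\<close> by change of basis sends a product to \<open>g (g\<^sup>-\<^sup>1 x \<cdot> g\<^sup>-\<^sup>1 y)\<close>.\<close>

definition basis_change :: "complex ^ 'm ^ 'm \<Rightarrow> complex ^ 'n ^ 'n \<Rightarrow>
    ('m::finite, 'n::finite) sconst \<Rightarrow> ('m, 'n) sconst" where
  "basis_change P Q A = sconst_of (\<lambda>x y.
     block_map P Q (mult_of A (block_map (matrix_inv P) (matrix_inv Q) x)
                              (block_map (matrix_inv P) (matrix_inv Q) y)))"

definition orbit :: "('m::finite, 'n::finite) sconst \<Rightarrow> ('m, 'n) sconst set" where
  "orbit A = {basis_change P Q A | P Q. invertible P \<and> invertible Q}"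


section \<open>The Zariski topology\<close>

inductive_set poly_functions :: "(complex ^ 'i::finite \<Rightarrow> complex) set" where
  const: "(\<lambda>x. c) \<in> poly_functions"
| coord: "(\<lambda>x. x $ i) \<in> poly_functions"
| add: "p \<in> poly_functions \<Longrightarrow> q \<in> poly_functions \<Longrightarrow> (\<lambda>x. p x + q x) \<in> poly_functions"
| mult: "p \<in> poly_functions \<Longrightarrow> q \<in> poly_functions \<Longrightarrow> (\<lambda>x. p x * q x) \<in> poly_functions"

definition zero_set :: "(complex ^ 'i::finite \<Rightarrow> complex) set \<Rightarrow> (complex ^ 'i) set" where
  "zero_set F = {x. \<forall>p\<in>F. p x = 0}"

definition zariski :: "(complex ^ 'i::finite) topology" where
  "zariski = topology (\<lambda>U. \<exists>F\<subseteq>poly_functions. U = - zero_set F)"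

lemma openin_zariski:
  fixes U :: "(complex ^ 'i::finite) set"
  shows "openin zariski U \<longleftrightarrow> (\<exists>F\<subseteq>poly_functions. U = - zero_set F)"
proof -
  have "istopology (\<lambda>U. \<exists>F\<subseteq>poly_functions. U = - zero_set (F :: (complex ^ 'i \<Rightarrow> complex) set))"
    unfolding istopology_def
  proof (intro conjI allI impI)
    fix S T :: "(complex ^ 'i) set"
    assume "\<exists>F\<subseteq>poly_functions. S = - zero_set F" "\<exists>F\<subseteq>poly_functions. T = - zero_set F"
    then obtain F G where FG: "F \<subseteq> poly_functions" "G \<subseteq> poly_functions"
        "S = - zero_set F" "T = - zero_set G" by auto
    let ?H = "(\<lambda>(p, q) x. p x * q x) ` (F \<times> G)"
    have "?H \<subseteq> poly_functions"
      using FG by (auto intro!: poly_functions.mult)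
    moreover have "S \<inter> T = - zero_set ?H"
      unfolding FG zero_set_def by auto
    ultimately show "\<exists>F\<subseteq>poly_functions. S \<inter> T = - zero_set F" by blast
  next
    fix K :: "(complex ^ 'i) set set"
    assume "\<forall>S\<in>K. \<exists>F\<subseteq>poly_functions. S = - zero_set F"
    then obtain f where f: "\<And>S. S \<in> K \<Longrightarrow> f S \<subseteq> poly_functions \<and> S = - zero_set (f S)"
      by metis
    have "\<Union>K = - zero_set (\<Union>(f ` K))"
    proof (intro set_eqI)
      fix x
      have "x \<in> S \<longleftrightarrow> (\<exists>p\<in>f S. p x \<noteq> 0)" if "S \<in> K" for S
        using f[OF that] unfolding zero_set_def by blast
      then show "x \<in> \<Union>K \<longleftrightarrow> x \<in> - zero_set (\<Union>(f ` K))"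
        unfolding zero_set_def by auto
    qed
    then show "\<exists>F\<subseteq>poly_functions. \<Union>K = - zero_set F"
      using f by (intro exI[of _ "\<Union>(f ` K)"]) auto
  qed
  then show ?thesis
    by (simp add: zariski_def topology_inverse')
qed

lemma topspace_zariski [simp]: "topspace zariski = (UNIV :: (complex ^ 'i::finite) set)"
proof -
  have "openin zariski (UNIV :: (complex ^ 'i) set)"
    unfolding openin_zariski zero_set_def
    by (intro exI[of _ "{\<lambda>x. 1}"]) (auto intro: poly_functions.const)
  then show ?thesis
    using openin_subset by blast
qed

lemma closedin_zariski: "closedin zariski S \<longleftrightarrow> (\<exists>F\<subseteq>poly_functions. S = zero_set F)"
  by (auto simp: closedin_def openin_zariski Compl_eq_Diff_UNIV[symmetric])

definition irreducible_space :: "'a topology \<Rightarrow> bool" where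
  "irreducible_space X \<longleftrightarrow> topspace X \<noteq> {} \<and>
     (\<forall>A B. closedin X A \<and> closedin X B \<and> topspace X = A \<union> B \<longrightarrow>
        A = topspace X \<or> B = topspace X)"

definition irreducible_components :: "'a topology \<Rightarrow> 'a set set" where
  "irreducible_components X =
     {C. C \<subseteq> topspace X \<and> irreducible_space (subtopology X C) \<and>
         (\<forall>D. D \<subseteq> topspace X \<and> irreducible_space (subtopology X D) \<and> C \<subseteq> D \<longrightarrow> D = C)}"

definition rigid :: "('m::finite, 'n::finite) sconst \<Rightarrow> bool" where
  "rigid A \<longleftrightarrow> A \<in> NJS \<and> openin (subtopology zariski NJS) (orbit A)"


section \<open>Multiplication tables in type (1,4)\<close>

text \<open>
  The index type \<open>1\<close> has one element; the index type \<open>4\<close> consists of \<open>1, 2, 3\<close> and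
  \<open>4\<close>, where \<open>4 = 0\<close>.

  \<open>table14 L W\<close> has the products \<open>e\<^sub>1 f\<^sub>j = f\<^sub>k\<close> for \<open>(j, k) \<in> L\<close> and
  \<open>f\<^sub>i f\<^sub>j = e\<^sub>1 = - f\<^sub>j f\<^sub>i\<close> for \<open>(i, j) \<in> W\<close>; other products of basis vectors vanish.
  It is meant for single-valued \<open>L\<close> and for \<open>W\<close> disjoint from its converse.
\<close>

definition table14 :: "(4 \<times> 4) set \<Rightarrow> (4 \<times> 4) set \<Rightarrow> (1, 4) sconst" where
  "table14 L W = (\<chi> s. case s of
       Inl _ \<Rightarrow> 0
     | Inr (Inl (_, j, k)) \<Rightarrow> of_bool ((j, k) \<in> L)
     | Inr (Inr (i, j, _)) \<Rightarrow> of_bool ((i, j) \<in> W) - of_bool ((j, i) \<in> W))"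

definition J3 :: "(1, 4) sconst" where
  "J3 = table14 {} {(1, 2), (3, 4)}"

definition J6 :: "(1, 4) sconst" where
  "J6 = table14 {(2, 1)} {(3, 4)}"

definition J7 :: "(1, 4) sconst" where
  "J7 = table14 {(2, 1), (3, 2)} {}"

definition J9 :: "(1, 4) sconst" where
  "J9 = table14 {(2, 1), (4, 3)} {(2, 4)}"

end

theory Submission
  imports Defs
begin

text \<open>
  Write \<open>e\<close> for the even basis vector. A supercommutative structure of type \<open>(1,n)\<close> amounts to a scalar \<open>c\<close> with
  \<open>e e = c e\<close>, the operator \<open>L f = e f\<close> on the odd part and the alternating form \<open>W\<close> with
  \<open>f g = W(f,g) e\<close>. Nilpotency forces \<open>c = 0\<close> and \<open>W(f, L g) = 0\<close>, because otherwise \<open>e\<close> could be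
  recovered from products involving \<open>e\<close> itself and would lie in every power. Given this, the Jordan
  identity is equivalent to \<open>L\<^sup>3 = 0\<close> together with \<open>W(f,g) L\<^sup>2 h = 0\<close>
  (\<open>NJS_iff_equations\<close>): either \<open>W = 0\<close> or \<open>L\<^sup>2 = 0\<close>. In particular the variety is Zariski closed.

  For \<open>n = 4\<close>, elementary linear algebra (\<open>classification\<close>) leaves four possibilities. If
  \<open>L\<^sup>2 \<noteq> 0\<close>, then \<open>W = 0\<close> and the algebra is \<open>J7\<close>. If \<open>W\<close> is nondegenerate, then \<open>L = 0\<close> and it is
  \<open>J3\<close>. If \<open>W\<close> has rank 2 and \<open>L\<close> does not vanish on the radical of \<open>W\<close>, it is \<open>J6\<close>. In all
  other cases some basis \<open>f\<^sub>1, \<dots>, f\<^sub>4\<close> has \<open>L\<close> mapping \<open>f\<^sub>1, f\<^sub>2\<close> into the span of \<open>f\<^sub>3, f\<^sub>4\<close> and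
  killing \<open>f\<^sub>3, f\<^sub>4\<close>, while \<open>W\<close> only pairs \<open>f\<^sub>1\<close> with \<open>f\<^sub>2\<close>. Such an algebra is given by a 2 by 2
  matrix and a scalar; it is \<open>J9\<close> when both are invertible, and it is a limit of these along a line in
  general (\<open>J9_shape_in_closure\<close>). So the four orbit closures cover the variety.

  Each of the four orbits is cut out of the variety by the nonvanishing of an invariant family of
  polynomials (\<open>orbit_eq_condition\<close>), so it is open, and the four orbits are disjoint. Orbits
  are irreducible, because two group elements are joined by a line along which the action is
  rational (\<open>irreducible_orbit\<close>). In any space, finitely many disjoint irreducible open sets whose
  closures cover it have the irreducible components as their closures
  (\<open>irreducible_components_eq_closures\<close>). Finally, an open orbit meets one of the four closures, hence
  the orbit that is dense in this closure, and so equals it.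
\<close>

section \<open>Isomorphisms of superalgebras and change of basis\<close>

lemma sum_UNIV_Plus: "(\<Sum>s\<in>(UNIV::('a::finite + 'b::finite) set). f s) = (\<Sum>i\<in>UNIV. f (Inl i)) + (\<Sum>j\<in>UNIV. f (Inr j))"
  by (simp only: UNIV_Plus_UNIV[symmetric] sum.Plus finite comp_def)

lemma block_map_Inl: "block_map P Q v $ Inl i = (\<Sum>k\<in>UNIV. P $ i $ k * v $ Inl k)"
  and block_map_Inr: "block_map P Q v $ Inr j = (\<Sum>k\<in>UNIV. Q $ j $ k * v $ Inr k)"
  by (simp_all add: block_map_def matrix_vector_mult_def)

lemma gspace_eq_iff:
  "(v::('m::finite,'n::finite) gspace) = w \<longleftrightarrow> (\<forall>i. v $ Inl i = w $ Inl i) \<and> (\<forall>j. v $ Inr j = w $ Inr j)"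
  by (metis (no_types) vec_eq_iff sum.exhaust)

lemma mult_of_Inl: "mult_of A x y $ Inl k =
     (\<Sum>i\<in>UNIV. \<Sum>j\<in>UNIV. x $ Inl i * y $ Inl j * A $ Inl (i, j, k))
   + (\<Sum>i\<in>UNIV. \<Sum>j\<in>UNIV. x $ Inr i * y $ Inr j * A $ Inr (Inr (i, j, k)))"
  by (simp add: mult_of_def sum_UNIV_Plus bvec_def axis_def sum.distrib if_distrib cong: if_cong)

lemma mult_of_Inr: "mult_of A x y $ Inr k =
     (\<Sum>i\<in>UNIV. \<Sum>j\<in>UNIV. (x $ Inl i * y $ Inr j + y $ Inl i * x $ Inr j) * A $ Inr (Inl (i, j, k)))"
  apply (simp add: mult_of_def sum_UNIV_Plus bvec_def axis_def sum.distrib if_distrib algebra_simps cong: if_cong)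
  apply (subst sum.swap)
  apply (simp add: algebra_simps)
  done

lemma linear_mult_of_right: "Vector_Spaces.linear (*s) (*s) (\<lambda>y. mult_of A x y)"
  by unfold_locales
    (simp_all add: gspace_eq_iff mult_of_Inl mult_of_Inr algebra_simps sum.distrib sum_distrib_left)

lemma linear_mult_of_left: "Vector_Spaces.linear (*s) (*s) (\<lambda>x. mult_of A x y)"
  by unfold_locales
    (simp_all add: gspace_eq_iff mult_of_Inl mult_of_Inr algebra_simps sum.distrib sum_distrib_left)

lemma linear_block_map: "Vector_Spaces.linear (*s) (*s) (block_map P Q)"
  by unfold_locales
    (simp_all add: gspace_eq_iff block_map_Inl block_map_Inr algebra_simps sum.distrib sum_distrib_left)

lemma superalgebra_mult_of: "superalgebra (mult_of A)"
  unfolding superalgebra_def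
  using linear_mult_of_left linear_mult_of_right
  by (auto simp: hpart_def mult_of_Inl mult_of_Inr)

lemma block_map_compose: "block_map P Q (block_map P' Q' v) = block_map (P ** P') (Q ** Q') v"
  by (simp add: block_map_def matrix_vector_mul_assoc[symmetric] vec_eq_iff split: sum.split)

lemma block_map_mat_1 [simp]: "block_map (mat 1) (mat 1) v = v"
  by (simp add: block_map_def vec_eq_iff split: sum.split)

lemma matrix_inv_mult:
  fixes P :: "'a::field^'n^'n"
  assumes "invertible P" shows "P ** matrix_inv P = mat 1" "matrix_inv P ** P = mat 1"
  using someI_ex[OF assms[unfolded invertible_def]] by (auto simp: matrix_inv_def)

lemma block_map_inverse:
  assumes "invertible P" "invertible Q"
  shows "block_map P Q (block_map (matrix_inv P) (matrix_inv Q) v) = v"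
    and "block_map (matrix_inv P) (matrix_inv Q) (block_map P Q v) = v"
  using assms by (simp_all add: block_map_compose matrix_inv_mult)

lemma bvec_nth: "bvec s $ t = of_bool (s = t)"
  by (auto simp: bvec_def axis_def)

lemma gspace_expansion: "(v :: ('m::finite,'n::finite) gspace) = (\<Sum>s\<in>UNIV. v $ s *s bvec s)"
  by (simp add: vec_eq_iff bvec_nth of_bool_def if_distrib cong: if_cong)

lemma linear_expansion:
  assumes "Vector_Spaces.linear (*s) (*s) h"
  shows "h (v :: ('m::finite,'n::finite) gspace) = (\<Sum>s\<in>UNIV. v $ s *s h (bvec s))"
proof -
  interpret Vector_Spaces.linear "(*s)" "(*s)" h by fact
  show ?thesis by (subst gspace_expansion[of v]) (simp add: sum scale)
qed

lemma sconst_of_nth: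
  "sconst_of mul $ Inl (i, j, k) = mul (bvec (Inl i)) (bvec (Inl j)) $ Inl k"
  "sconst_of mul $ Inr (Inl (i, j', k')) = mul (bvec (Inl i)) (bvec (Inr j')) $ Inr k'"
  "sconst_of mul $ Inr (Inr (i', j', k)) = mul (bvec (Inr i')) (bvec (Inr j')) $ Inl k"
  by (simp_all add: sconst_of_def)

lemma mult_of_bvec: "mult_of A (bvec s) (bvec t) = basis_mult A s t"
proof -
  have "mult_of A (bvec s) (bvec t) =
      (\<Sum>s'\<in>UNIV. if s' = s then \<Sum>t'\<in>UNIV. if t' = t then basis_mult A s' t' else 0 else 0)"
    unfolding mult_of_def by (intro sum.cong refl) (auto simp: bvec_nth if_distrib[of "\<lambda>c. c *s _"] of_bool_def cong: if_cong)
  then show ?thesis by simp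
qed

lemma sconst_eq_iff: "(A::('m::finite,'n::finite) sconst) = B \<longleftrightarrow>
   (\<forall>i j k. A $ Inl (i, j, k) = B $ Inl (i, j, k)) \<and>
   (\<forall>i j k. A $ Inr (Inl (i, j, k)) = B $ Inr (Inl (i, j, k))) \<and>
   (\<forall>i j k. A $ Inr (Inr (i, j, k)) = B $ Inr (Inr (i, j, k)))"
  unfolding vec_eq_iff by (metis sum.exhaust prod.exhaust)

lemma sconst_of_mult_of: "sconst_of (mult_of A) = A"
  by (simp add: sconst_eq_iff sconst_of_nth mult_of_bvec bvec_nth of_bool_def if_distrib cong: if_cong)

text \<open>
  The structure constants omit the products \<open>f\<^sub>j e\<^sub>i\<close>, which is why these have to agree with \<open>e\<^sub>i f\<^sub>j\<close>.
\<close>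

lemma mult_of_sconst_of:
  assumes "superalgebra mul"
    and "\<And>i j. mul (bvec (Inr j)) (bvec (Inl i)) = mul (bvec (Inl i)) (bvec (Inr j))"
  shows "mult_of (sconst_of mul) = mul"
proof (intro ext)
  fix x y :: "('a,'b) gspace"
  have hp: "bvec (Inl i) \<in> hpart 0" "bvec (Inr j) \<in> hpart 1" for i :: 'a and j :: 'b
    by (auto simp: hpart_def bvec_nth)
  have grade: "x \<in> hpart a \<Longrightarrow> y \<in> hpart b \<Longrightarrow> a \<in> {0,1} \<Longrightarrow> b \<in> {0,1} \<Longrightarrow> mul x y \<in> hpart (a + b)" for x y a b
    using assms(1) by (auto simp: superalgebra_def)
  have "mul (bvec s) (bvec t) = basis_mult (sconst_of mul) s t" for s t
    using grade[OF hp(1) hp(1)] grade[OF hp(1) hp(2)] grade[OF hp(2) hp(2)]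
    by (cases s; cases t; simp add: assms(2) gspace_eq_iff sconst_of_nth bvec_nth if_distrib of_bool_def hpart_def cong: if_cong)
  moreover have "mul x y = (\<Sum>s\<in>UNIV. \<Sum>t\<in>UNIV. (x $ s * y $ t) *s mul (bvec s) (bvec t))"
  proof -
    have l: "Vector_Spaces.linear (*s) (*s) (\<lambda>y. mul x y)" "Vector_Spaces.linear (*s) (*s) (\<lambda>x. mul x y)" for x y
      using assms(1) by (auto simp: superalgebra_def)
    have "mul x y = (\<Sum>s\<in>UNIV. x $ s *s mul (bvec s) y)"
      using linear_expansion[OF l(2)] .
    also have "\<dots> = (\<Sum>s\<in>UNIV. x $ s *s (\<Sum>t\<in>UNIV. y $ t *s mul (bvec s) (bvec t)))"
      using linear_expansion[OF l(1), of _ y] by metis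
    finally show ?thesis by (simp add: vec.scale_sum_right)
  qed
  ultimately show "mult_of (sconst_of mul) x y = mul x y"
    by (simp add: mult_of_def)
qed

lemma mult_of_basis_change:
  assumes "invertible P" "invertible Q"
  shows "mult_of (basis_change P Q A) x y =
    block_map P Q (mult_of A (block_map (matrix_inv P) (matrix_inv Q) x) (block_map (matrix_inv P) (matrix_inv Q) y))"
proof -
  let ?g = "block_map P Q" and ?h = "block_map (matrix_inv P) (matrix_inv Q)"
  let ?m = "\<lambda>x y. ?g (mult_of A (?h x) (?h y))"
  interpret g: Vector_Spaces.linear "(*s)" "(*s)" ?g by (rule linear_block_map)
  interpret h: Vector_Spaces.linear "(*s)" "(*s)" ?h by (rule linear_block_map)
  interpret l: Vector_Spaces.linear "(*s)" "(*s)" "\<lambda>y. mult_of A x y" for x by (rule linear_mult_of_right)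
  interpret r: Vector_Spaces.linear "(*s)" "(*s)" "\<lambda>x. mult_of A x y" for y by (rule linear_mult_of_left)
  have hp: "block_map P Q v \<in> hpart a" if "v \<in> hpart a" for a v and P :: "complex^'a^'a" and Q :: "complex^'b^'b"
    using that by (auto simp: hpart_def block_map_Inl block_map_Inr split: if_splits)
  have "superalgebra ?m"
    unfolding superalgebra_def
  proof (intro conjI ballI allI)
    fix a b :: nat and x y :: "('a,'b) gspace" assume ab: "a \<in> {0,1}" "b \<in> {0,1}" "x \<in> hpart a" "y \<in> hpart b"
    show "?m x y \<in> hpart (a + b)"
      using superalgebra_mult_of[of A] ab unfolding superalgebra_def by (blast intro: hp)
  next
    show "Vector_Spaces.linear (*s) (*s) (\<lambda>y. ?m x y)" for x
      by unfold_locales (simp_all only: g.add h.add l.add g.scale h.scale l.scale)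
    show "Vector_Spaces.linear (*s) (*s) (\<lambda>x. ?m x y)" for y
      by unfold_locales (simp_all only: g.add h.add r.add g.scale h.scale r.scale)
  qed
  moreover have "mult_of A (?h (bvec (Inr j))) (?h (bvec (Inl i))) = mult_of A (?h (bvec (Inl i))) (?h (bvec (Inr j)))" for i j
    by (simp add: gspace_eq_iff mult_of_Inl mult_of_Inr block_map_Inl block_map_Inr bvec_nth mult.commute)
  ultimately have "mult_of (sconst_of ?m) = ?m"
    by (intro mult_of_sconst_of) auto
  then show ?thesis unfolding basis_change_def by metis
qed

text \<open>
  Moving the inverses to the other side gives a description of the orbit that contains no matrix inverse.
\<close>

lemma orbit_iff_block_map:
  "B \<in> orbit A \<longleftrightarrow> (\<exists>P Q. invertible P \<and> invertible Q \<and>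
     (\<forall>x y. block_map P Q (mult_of A x y) = mult_of B (block_map P Q x) (block_map P Q y)))"
proof
  assume "B \<in> orbit A"
  then show "\<exists>P Q. invertible P \<and> invertible Q \<and>
     (\<forall>x y. block_map P Q (mult_of A x y) = mult_of B (block_map P Q x) (block_map P Q y))"
    unfolding orbit_def by (force simp: mult_of_basis_change block_map_inverse)
next
  assume "\<exists>P Q. invertible P \<and> invertible Q \<and>
     (\<forall>x y. block_map P Q (mult_of A x y) = mult_of B (block_map P Q x) (block_map P Q y))"
  then obtain P Q where PQ: "invertible P" "invertible Q"
     "\<And>x y. block_map P Q (mult_of A x y) = mult_of B (block_map P Q x) (block_map P Q y)" by blast
  have "basis_change P Q A = sconst_of (mult_of B)"
    unfolding basis_change_def by (simp add: PQ block_map_inverse)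
  then show "B \<in> orbit A"
    using PQ(1,2) unfolding orbit_def sconst_of_mult_of by blast
qed

text \<open>
  A linear map that preserves both homogeneous parts is block diagonal, so isomorphisms of
  superalgebras and elements of the group acting on structure constants are the same thing.
\<close>

lemma graded_linear_eq_block_map:
  assumes "Vector_Spaces.linear (*s) (*s) h" and "\<forall>p\<in>{0,1}. \<forall>v\<in>hpart p. h v \<in> hpart p"
  shows "h v = block_map (\<chi> i j. h (bvec (Inl j)) $ Inl i) (\<chi> i j. h (bvec (Inr j)) $ Inr i) v"
proof -
  have hp: "h (bvec (Inl i)) \<in> hpart 0" "h (bvec (Inr j)) \<in> hpart 1" for i j
    using assms(2) by (auto simp: hpart_def bvec_nth)
  show ?thesis
    unfolding linear_expansion[OF assms(1), of v]
    using hp by (simp add: gspace_eq_iff sum_UNIV_Plus block_map_Inl block_map_Inr hpart_def mult.commute)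
qed

lemma orbit_iff_iso: "B \<in> orbit A \<longleftrightarrow> superalgebra_iso (mult_of A) (mult_of B)"
proof
  assume "B \<in> orbit A"
  then obtain P Q where PQ: "invertible P" "invertible Q"
     "\<And>x y. block_map P Q (mult_of A x y) = mult_of B (block_map P Q x) (block_map P Q y)"
    unfolding orbit_iff_block_map by blast
  have "bij (block_map P Q)"
    by (rule bij_betw_byWitness[of _ "block_map (matrix_inv P) (matrix_inv Q)"])
       (use PQ in \<open>auto simp: block_map_inverse\<close>)
  moreover have "\<forall>p\<in>{0,1}. \<forall>v\<in>hpart p. block_map P Q v \<in> hpart p"
    by (auto simp: hpart_def block_map_Inl block_map_Inr)
  ultimately show "superalgebra_iso (mult_of A) (mult_of B)"
    unfolding superalgebra_iso_def using PQ linear_block_map by blast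
next
  assume "superalgebra_iso (mult_of A) (mult_of B)"
  then obtain h where h: "Vector_Spaces.linear (*s) (*s) h" "bij h" "\<forall>p\<in>{0,1}. \<forall>v\<in>hpart p. h v \<in> hpart p"
     "\<And>x y. h (mult_of A x y) = mult_of B (h x) (h y)"
    unfolding superalgebra_iso_def by blast
  define P where "P = (\<chi> i j. h (bvec (Inl j)) $ Inl i)"
  define Q where "Q = (\<chi> i j. h (bvec (Inr j)) $ Inr i)"
  have eq: "h = block_map P Q"
    unfolding P_def Q_def by (intro ext graded_linear_eq_block_map h)
  have inj: "v = 0" if "block_map P Q v = 0" for v
    using that h(2) vec.linear_inj_iff_eq_0[OF h(1)] unfolding eq bij_def by blast
  have "x = 0" if "P *v x = 0" for x
    using inj[of "\<chi> s. case s of Inl i \<Rightarrow> x $ i | Inr j \<Rightarrow> 0"] that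
    by (simp add: gspace_eq_iff block_map_def vec_eq_iff matrix_vector_mult_def)
  moreover have "x = 0" if "Q *v x = 0" for x
    using inj[of "\<chi> s. case s of Inl i \<Rightarrow> 0 | Inr j \<Rightarrow> x $ j"] that
    by (simp add: gspace_eq_iff block_map_def vec_eq_iff matrix_vector_mult_def)
  ultimately have "invertible P" "invertible Q"
    by (auto simp: invertible_left_inverse matrix_left_invertible_ker)
  then show "B \<in> orbit A"
    using h(4) unfolding orbit_iff_block_map eq by blast
qed

lemma superalgebra_iso_sym:
  assumes "superalgebra_iso M N" shows "superalgebra_iso N M"
proof -
  obtain h where h: "Vector_Spaces.linear (*s) (*s) h" "bij h" "\<forall>p\<in>{0,1}. \<forall>v\<in>hpart p. h v \<in> hpart p"
     "\<And>x y. h (M x y) = N (h x) (h y)"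
    using assms unfolding superalgebra_iso_def by blast
  interpret h: Vector_Spaces.linear "(*s)" "(*s)" h by fact
  let ?k = "inv h"
  have hk: "h (?k v) = v" and kh: "?k (h v) = v" for v
    using h(2) by (auto simp: bij_def surj_f_inv_f)
  have "Vector_Spaces.linear (*s) (*s) ?k"
    by unfold_locales (metis h.add hk kh, metis h.scale hk kh)
  moreover have "bij ?k" using h(2) by (rule bij_imp_bij_inv)
  moreover have "?k v \<in> hpart p" if p: "p \<in> {0,1}" and v: "v \<in> hpart p" for p v
  proof -
    (* Split the preimage into its homogeneous parts and use injectivity on the wrong one. *)
    define a where "a = ((\<chi> s. case s of Inl i \<Rightarrow> ?k v $ Inl i | Inr j \<Rightarrow> 0) :: ('a, 'b) gspace)"
    define b where "b = ((\<chi> s. case s of Inl i \<Rightarrow> 0 | Inr j \<Rightarrow> ?k v $ Inr j) :: ('a, 'b) gspace)"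
    have ab: "?k v = a + b" "a \<in> hpart 0" "b \<in> hpart 1"
      by (auto simp: a_def b_def gspace_eq_iff hpart_def)
    have hab: "h a \<in> hpart 0" "h b \<in> hpart 1" "v = h a + h b"
      using h(3) ab hk[of v] by (auto simp: h.add)
    consider "p = 0" | "p = 1" using p by auto
    then show ?thesis
    proof cases
      case 1
      then have "h b = h 0" using hab v by (simp add: gspace_eq_iff hpart_def)
      then have "b = 0" using h(2) by (metis bij_def injD)
      then show ?thesis using ab 1 by simp
    next
      case 2
      then have "h a = h 0" using hab v by (simp add: gspace_eq_iff hpart_def)
      then have "a = 0" using h(2) by (metis bij_def injD)
      then show ?thesis using ab 2 by simp
    qed
  qed
  moreover have "?k (N x y) = M (?k x) (?k y)" for x y
    by (metis h(4) hk kh)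
  ultimately show ?thesis unfolding superalgebra_iso_def by blast
qed

lemma superalgebra_iso_trans:
  assumes "superalgebra_iso M N" "superalgebra_iso N K" shows "superalgebra_iso M K"
proof -
  obtain h k where h: "Vector_Spaces.linear (*s) (*s) h" "bij h" "\<forall>p\<in>{0,1}. \<forall>v\<in>hpart p. h v \<in> hpart p"
     "\<And>x y. h (M x y) = N (h x) (h y)"
    and k: "Vector_Spaces.linear (*s) (*s) k" "bij k" "\<forall>p\<in>{0,1}. \<forall>v\<in>hpart p. k v \<in> hpart p"
     "\<And>x y. k (N x y) = K (k x) (k y)"
    using assms unfolding superalgebra_iso_def by blast
  have "Vector_Spaces.linear (*s) (*s) (k \<circ> h)" by (rule Vector_Spaces.linear_compose[OF h(1) k(1)])
  moreover have "bij (k \<circ> h)" using h(2) k(2) by (rule bij_comp)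
  ultimately show ?thesis
    unfolding superalgebra_iso_def using h(3,4) k(3,4) by (intro exI[of _ "k \<circ> h"]) (simp only: o_apply; blast)
qed

lemma self_in_orbit: "A \<in> orbit A"
proof -
  show ?thesis unfolding orbit_iff_block_map
    by (intro exI[of _ "mat 1"] conjI) (auto simp: invertible_def)
qed

lemma orbit_eq_iff: "orbit A = orbit B \<longleftrightarrow> B \<in> orbit A"
proof
  assume "orbit A = orbit B" then show "B \<in> orbit A" using self_in_orbit[of B] by simp
next
  assume B: "B \<in> orbit A"
  show "orbit A = orbit B"
  proof (intro set_eqI)
    fix C show "C \<in> orbit A \<longleftrightarrow> C \<in> orbit B"
      using B unfolding orbit_iff_iso by (blast intro: superalgebra_iso_sym superalgebra_iso_trans)
  qed
qed

section \<open>Irreducible subsets and rational curves in the Zariski topology\<close>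

text \<open>
  The functions on \<open>D\<close> given by a quotient of two polynomials whose denominator has no zero in \<open>D\<close>.
  They form a ring, contain the entries of the inverse of a matrix depending linearly on the
  parameter, and inherit from polynomials the absence of zero divisors when \<open>D\<close> is cofinite.
\<close>

definition rational_on :: "complex set \<Rightarrow> (complex \<Rightarrow> complex) \<Rightarrow> bool" where
  "rational_on D f \<longleftrightarrow> (\<exists>a b. \<forall>t\<in>D. poly b t \<noteq> 0 \<and> f t * poly b t = poly a t)"

lemma rational_on_const: "rational_on D (\<lambda>t. c)"
  unfolding rational_on_def by (intro exI[of _ "[:c:]"] exI[of _ "[:1:]"]) simp

lemma rational_on_ident: "rational_on D (\<lambda>t. t)"
  unfolding rational_on_def by (intro exI[of _ "[:0,1:]"] exI[of _ "[:1:]"]) simp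

lemma rational_on_add:
  assumes "rational_on D f" "rational_on D g" shows "rational_on D (\<lambda>t. f t + g t)"
proof -
  obtain a b c d where "\<forall>t\<in>D. poly b t \<noteq> 0 \<and> f t * poly b t = poly a t"
    "\<forall>t\<in>D. poly d t \<noteq> 0 \<and> g t * poly d t = poly c t"
    using assms unfolding rational_on_def by metis
  then show ?thesis unfolding rational_on_def
    by (intro exI[of _ "a * d + c * b"] exI[of _ "b * d"]) (auto simp: algebra_simps)
qed

lemma rational_on_mult:
  assumes "rational_on D f" "rational_on D g" shows "rational_on D (\<lambda>t. f t * g t)"
proof -
  obtain a b c d where "\<forall>t\<in>D. poly b t \<noteq> 0 \<and> f t * poly b t = poly a t"
    "\<forall>t\<in>D. poly d t \<noteq> 0 \<and> g t * poly d t = poly c t"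
    using assms unfolding rational_on_def by metis
  then show ?thesis unfolding rational_on_def
    by (intro exI[of _ "a * c"] exI[of _ "b * d"]) (auto simp: algebra_simps)
qed

lemma rational_on_divide:
  assumes "rational_on D f" "rational_on D g" "\<And>t. t \<in> D \<Longrightarrow> g t \<noteq> 0"
  shows "rational_on D (\<lambda>t. f t / g t)"
proof -
  obtain a b c d where ab: "\<forall>t\<in>D. poly b t \<noteq> 0 \<and> f t * poly b t = poly a t"
    and cd: "\<forall>t\<in>D. poly d t \<noteq> 0 \<and> g t * poly d t = poly c t"
    using assms unfolding rational_on_def by metis
  have "poly (b * c) t \<noteq> 0 \<and> f t / g t * poly (b * c) t = poly (a * d) t" if "t \<in> D" for t
  proof -
    have "poly c t = g t * poly d t" "poly a t = f t * poly b t" "poly b t \<noteq> 0" "poly d t \<noteq> 0"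
      using ab cd that by auto
    then show ?thesis using assms(3)[OF that] by simp
  qed
  then show ?thesis unfolding rational_on_def by blast
qed

lemma rational_on_sum: "(\<And>i. i \<in> I \<Longrightarrow> rational_on D (f i)) \<Longrightarrow> rational_on D (\<lambda>t. \<Sum>i\<in>I. f i t)"
  by (induction I rule: infinite_finite_induct) (auto intro: rational_on_const rational_on_add)

lemma rational_on_prod: "(\<And>i. i \<in> I \<Longrightarrow> rational_on D (f i)) \<Longrightarrow> rational_on D (\<lambda>t. \<Prod>i\<in>I. f i t)"
  by (induction I rule: infinite_finite_induct) (auto intro: rational_on_const rational_on_mult)

lemmas rational_on_intros = rational_on_const rational_on_ident rational_on_add rational_on_mult
  rational_on_sum rational_on_prod

lemma rational_on_UNIV_zero_or_cofinite:
  assumes "rational_on UNIV f" "f z \<noteq> 0" shows "finite {t. f t = 0}"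
proof -
  obtain a b where ab: "\<And>t. poly b t \<noteq> 0 \<and> f t * poly b t = poly a t"
    using assms unfolding rational_on_def by auto
  then have "poly a z \<noteq> 0" using assms(2) by (metis mult_eq_0_iff)
  then have "finite {t. poly a t = 0}" by (intro poly_roots_finite) auto
  then show ?thesis by (rule finite_subset[rotated]) (use ab in \<open>auto, metis mult_zero_left\<close>)
qed

text \<open>
  A cofinite set is infinite, so the product of the two numerator polynomials is the zero polynomial.
\<close>

lemma rational_on_mult_eq_0:
  assumes "finite (- D)" "rational_on D f" "rational_on D g" "\<And>t. t \<in> D \<Longrightarrow> f t * g t = 0"
  shows "(\<forall>t\<in>D. f t = 0) \<or> (\<forall>t\<in>D. g t = 0)"
proof -
  obtain a b c d where ab: "\<forall>t\<in>D. poly b t \<noteq> 0 \<and> f t * poly b t = poly a t"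
    and cd: "\<forall>t\<in>D. poly d t \<noteq> 0 \<and> g t * poly d t = poly c t"
    using assms(2,3) unfolding rational_on_def by metis
  have "infinite D" using assms(1) infinite_UNIV_char_0[where 'a=complex]
    by (auto dest: finite_Un[THEN iffD2, OF conjI, of D "- D"])
  moreover have "D \<subseteq> {t. poly (a * c) t = 0}"
  proof
    fix t assume t: "t \<in> D"
    have "poly (a * c) t = (f t * g t) * (poly b t * poly d t)"
      using bspec[OF ab t, THEN conjunct2, symmetric] bspec[OF cd t, THEN conjunct2, symmetric]
      by (simp only: poly_mult mult_ac)
    then show "t \<in> {t. poly (a * c) t = 0}" using assms(4)[OF t] by simp
  qed
  ultimately have "a * c = 0"
    using poly_roots_finite finite_subset by blast
  then have "a = 0 \<or> c = 0" by simp
  then show ?thesis using ab cd by fastforce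
qed

lemma rational_on_poly_function:
  assumes "p \<in> poly_functions" "\<And>i. rational_on D (\<lambda>t. x t $ i)"
  shows "rational_on D (\<lambda>t. p (x t))"
  using assms by (induction rule: poly_functions.induct) (auto intro: rational_on_intros)

lemma rational_on_det:
  assumes "\<And>i j. rational_on D (\<lambda>t. M t $ i $ j)" shows "rational_on D (\<lambda>t. det (M t))"
  unfolding det_def by (intro rational_on_intros assms)

lemma matrix_inv_nth_cramer:
  fixes M :: "'a::field^'n^'n"
  assumes "invertible M"
  shows "matrix_inv M $ k $ l = det (\<chi> i j. if j = k then of_bool (i = l) else M $ i $ j) / det M"
proof -
  have "M *v (matrix_inv M *v axis l 1) = axis l 1"
    by (simp add: matrix_vector_mul_assoc matrix_inv_mult assms)
  then have "matrix_inv M *v axis l 1 = (\<chi> k. det (\<chi> i j. if j = k then axis l 1 $ i else M $ i $ j) / det M)"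
    using cramer[of M] assms by (simp add: invertible_det_nz)
  then have "(matrix_inv M *v axis l 1) $ k = det (\<chi> i j. if j = k then axis l 1 $ i else M $ i $ j) / det M"
    by simp
  moreover have "(matrix_inv M *v axis l 1) $ k = matrix_inv M $ k $ l"
    by (simp add: matrix_vector_mult_def axis_def if_distrib cong: if_cong)
  ultimately show ?thesis by (simp add: axis_def of_bool_def cong: if_cong)
qed

lemma rational_on_matrix_inv:
  fixes M :: "complex \<Rightarrow> complex^'n^'n"
  assumes "\<And>i j. rational_on D (\<lambda>t. M t $ i $ j)" "\<And>t. t \<in> D \<Longrightarrow> invertible (M t)"
  shows "rational_on D (\<lambda>t. matrix_inv (M t) $ k $ l)"
proof -
  have "rational_on D (\<lambda>t. det (\<chi> i j. if j = k then of_bool (i = l) else M t $ i $ j) / det (M t))"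
  proof (intro rational_on_divide rational_on_det assms)
    show "det (M t) \<noteq> 0" if "t \<in> D" for t using assms(2)[OF that] by (simp add: invertible_det_nz)
    show "rational_on D (\<lambda>t. (\<chi> i j. if j = k then of_bool (i = l) else M t $ i $ j) $ i $ j)" for i j
      by (cases "j = k") (simp_all add: assms rational_on_const)
  qed
  then show ?thesis
    unfolding rational_on_def using assms(2) by (simp add: matrix_inv_nth_cramer)
qed

lemma rational_on_block_map:
  assumes "\<And>i j. rational_on D (\<lambda>t. P t $ i $ j)" "\<And>i j. rational_on D (\<lambda>t. Q t $ i $ j)"
    "\<And>s. rational_on D (\<lambda>t. v t $ s)"
  shows "rational_on D (\<lambda>t. block_map (P t) (Q t) (v t) $ s)"
  by (cases s; simp only: block_map_Inl block_map_Inr; intro rational_on_intros assms)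

lemma rational_on_mult_of:
  assumes "\<And>s. rational_on D (\<lambda>t. x t $ s)" "\<And>s. rational_on D (\<lambda>t. y t $ s)"
  shows "rational_on D (\<lambda>t. mult_of A (x t) (y t) $ s)"
  by (cases s; simp only: mult_of_Inl mult_of_Inr; intro rational_on_intros assms)

lemma rational_on_basis_change:
  assumes "\<And>i j. rational_on D (\<lambda>t. P t $ i $ j)" "\<And>i j. rational_on D (\<lambda>t. Q t $ i $ j)"
    "\<And>t. t \<in> D \<Longrightarrow> invertible (P t)" "\<And>t. t \<in> D \<Longrightarrow> invertible (Q t)"
  shows "rational_on D (\<lambda>t. basis_change (P t) (Q t) A $ s)"
proof -
  have *: "rational_on D (\<lambda>t. block_map (P t) (Q t) (mult_of A (block_map (matrix_inv (P t)) (matrix_inv (Q t)) u)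
                              (block_map (matrix_inv (P t)) (matrix_inv (Q t)) v)) $ r)" for u v r
    by (intro rational_on_block_map rational_on_mult_of rational_on_matrix_inv assms rational_on_const)
  consider i j k where "s = Inl (i, j, k)" | i j k where "s = Inr (Inl (i, j, k))"
    | i j k where "s = Inr (Inr (i, j, k))"
    by (metis sum.exhaust prod.exhaust)
  then show ?thesis
    by cases (simp_all only: basis_change_def sconst_of_nth *)
qed

text \<open>
  Irreducibility of a subspace expressed by closed sets of the ambient space; in this form it passes
  to closures at once.
\<close>

lemma irreducible_space_subtopology:
  assumes "S \<subseteq> topspace X"
  shows "irreducible_space (subtopology X S) \<longleftrightarrow> S \<noteq> {} \<and>
    (\<forall>A B. closedin X A \<and> closedin X B \<and> S \<subseteq> A \<union> B \<longrightarrow> S \<subseteq> A \<or> S \<subseteq> B)"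
proof -
  have ts: "topspace (subtopology X S) = S" using assms by auto
  show ?thesis
    unfolding irreducible_space_def ts
  proof (intro conj_cong refl iffI allI impI; elim conjE)
    fix A B assume H: "\<forall>A B. closedin (subtopology X S) A \<and> closedin (subtopology X S) B \<and> S = A \<union> B \<longrightarrow> A = S \<or> B = S"
      and "closedin X A" "closedin X B" "S \<subseteq> A \<union> B"
    then have "closedin (subtopology X S) (A \<inter> S)" "closedin (subtopology X S) (B \<inter> S)" "S = (A \<inter> S) \<union> (B \<inter> S)"
      by (auto simp: closedin_subtopology)
    then have "A \<inter> S = S \<or> B \<inter> S = S" by (intro H[rule_format] conjI)
    then show "S \<subseteq> A \<or> S \<subseteq> B" by (simp only: inf.absorb_iff2 [symmetric])
  next
    fix A B assume H: "\<forall>A B. closedin X A \<and> closedin X B \<and> S \<subseteq> A \<union> B \<longrightarrow> S \<subseteq> A \<or> S \<subseteq> B"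
      and A: "closedin (subtopology X S) A" and B: "closedin (subtopology X S) B" and S: "S = A \<union> B"
    obtain A' where A': "closedin X A'" "A = A' \<inter> S" using A unfolding closedin_subtopology by (elim exE conjE)
    obtain B' where B': "closedin X B'" "B = B' \<inter> S" using B unfolding closedin_subtopology by (elim exE conjE)
    have "S \<subseteq> A' \<union> B'" by (subst S) (use A'(2) B'(2) in blast)
    then have "S \<subseteq> A' \<or> S \<subseteq> B'" using H A'(1) B'(1) by simp
    then show "A = S \<or> B = S" by (simp only: A'(2) B'(2) inf.absorb_iff2)
  qed
qed

text \<open>
  If two closed sets cover the orbit and each misses a point of it, there are polynomials \<open>f\<close> and
  \<open>g\<close>, one from each closed set, such that \<open>f g\<close> vanishes on the orbit while \<open>f\<close> and \<open>g\<close> do not vanish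
  at the two points. Joining the two group elements by a line, which consists of invertible matrices
  outside finitely many parameters, turns \<open>f\<close> and \<open>g\<close> into rational functions of one variable with
  product zero and neither of them zero.
\<close>

lemma irreducible_orbit:
  fixes A :: "('m::finite, 'n::finite) sconst"
  shows "irreducible_space (subtopology zariski (orbit A))"
proof (subst irreducible_space_subtopology, simp, intro conjI allI impI, goal_cases)
  case 1 show ?case using self_in_orbit by blast
next
  case (2 X Y)
  then obtain F G where F: "F \<subseteq> poly_functions" "X = zero_set F" and G: "G \<subseteq> poly_functions" "Y = zero_set G"
    by (auto simp: closedin_zariski)
  show ?case
  proof (rule ccontr)
    assume "\<not> ?case"
    then obtain B C where "B \<in> orbit A" "B \<notin> X" "C \<in> orbit A" "C \<notin> Y" by blast
    then obtain P Q P' Q' f g where B: "invertible P" "invertible Q" "f \<in> F" "f (basis_change P Q A) \<noteq> 0"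
      and C: "invertible P'" "invertible Q'" "g \<in> G" "g (basis_change P' Q' A) \<noteq> 0"
      unfolding orbit_def F G zero_set_def by blast
    define p where "p t = (\<chi> i j. P $ i $ j + t * (P' $ i $ j - P $ i $ j))" for t
    define q where "q t = (\<chi> i j. Q $ i $ j + t * (Q' $ i $ j - Q $ i $ j))" for t
    have pq: "rational_on D (\<lambda>t. p t $ i $ j)" "rational_on D (\<lambda>t. q t $ k $ l)" for D i j k l
      by (auto simp: p_def q_def intro!: rational_on_intros)
    have ends: "p 0 = P" "p 1 = P'" "q 0 = Q" "q 1 = Q'" by (simp_all add: p_def q_def vec_eq_iff)
    define D where "D = {t. det (p t) \<noteq> 0 \<and> det (q t) \<noteq> 0}"
    have inv: "invertible (p t)" "invertible (q t)" if "t \<in> D" for t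
      using that by (auto simp: D_def invertible_det_nz)
    have "finite {t. det (p t) = 0}" "finite {t. det (q t) = 0}"
      by (rule rational_on_UNIV_zero_or_cofinite[where z = 0];
          use B(1,2) in \<open>simp add: ends rational_on_det pq flip: invertible_det_nz\<close>)+
    moreover have "- D = {t. det (p t) = 0} \<union> {t. det (q t) = 0}" by (auto simp: D_def)
    ultimately have "finite (- D)" by (simp only: finite_Un simp_thms)
    moreover have "rational_on D (\<lambda>t. h (basis_change (p t) (q t) A))" if "h \<in> poly_functions" for h
      by (rule rational_on_poly_function[OF that rational_on_basis_change]) (fact pq inv)+
    moreover have "f (basis_change (p t) (q t) A) * g (basis_change (p t) (q t) A) = 0" if "t \<in> D" for t
    proof -
      have "basis_change (p t) (q t) A \<in> X \<union> Y" using inv[OF that] 2 unfolding orbit_def by blast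
      then show ?thesis using B(3) C(3) unfolding F G zero_set_def by auto
    qed
    ultimately have "(\<forall>t\<in>D. f (basis_change (p t) (q t) A) = 0) \<or> (\<forall>t\<in>D. g (basis_change (p t) (q t) A) = 0)"
      using B(3) C(3) F(1) G(1) by (intro rational_on_mult_eq_0) auto
    moreover have "0 \<in> D" "1 \<in> D" using B(1,2) C(1,2) by (auto simp: D_def ends invertible_det_nz)
    ultimately show False using B(4) C(4) ends by metis
  qed
qed

text \<open>
  A polynomial that vanishes on \<open>S\<close> becomes, along the line, a rational function whose product with
  \<open>\<delta>\<close> is zero; hence it vanishes identically, and in particular at the parameter \<open>0\<close>.
\<close>

lemma in_zariski_closure_along_line:
  assumes "rational_on UNIV \<delta>" "\<delta> z \<noteq> 0" "\<And>t. \<delta> t \<noteq> 0 \<Longrightarrow> A + t *s B \<in> S"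
  shows "A \<in> zariski closure_of S"
proof -
  have "A \<in> Z" if Z: "closedin zariski Z" "S \<subseteq> Z" for Z
  proof -
    obtain F where F: "F \<subseteq> poly_functions" "Z = zero_set F" using Z by (auto simp: closedin_zariski)
    have "f A = 0" if f: "f \<in> F" for f
    proof -
      have "f (A + t *s B) * \<delta> t = 0" for t
        using assms(3)[of t] f Z(2) F(2) by (auto simp: zero_set_def)
      moreover have "rational_on UNIV (\<lambda>t. f (A + t *s B))"
        by (rule rational_on_poly_function[OF subsetD[OF F(1) f]]) (auto intro!: rational_on_intros)
      ultimately have "\<forall>t. f (A + t *s B) = 0"
        using rational_on_mult_eq_0[of UNIV "\<lambda>t. f (A + t *s B)" \<delta>] assms(1,2) by auto
      from this[rule_format, of 0] show ?thesis by simp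
    qed
    then show ?thesis by (simp add: F zero_set_def)
  qed
  then show ?thesis
    by (metis closedin_closure_of closure_of_subset subset_UNIV topspace_zariski)
qed

text \<open>
  A nonempty open set of the family that lies in the closure of another member meets that member, so
  by disjointness no closure contains another; and an irreducible set lies in one of finitely many
  closed sets that cover it, hence in one of the closures.
\<close>

lemma irreducible_components_eq_closures:
  fixes X :: "'a topology" and \<U> :: "'a set set"
  assumes fin: "finite \<U>"
    and op: "\<And>U. U \<in> \<U> \<Longrightarrow> openin X U"
    and irr: "\<And>U. U \<in> \<U> \<Longrightarrow> irreducible_space (subtopology X U)"
    and disj: "\<And>U V. U \<in> \<U> \<Longrightarrow> V \<in> \<U> \<Longrightarrow> U \<noteq> V \<Longrightarrow> U \<inter> V = {}"
    and cover: "topspace X \<subseteq> (\<Union>U\<in>\<U>. X closure_of U)"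
  shows "irreducible_components X = (\<lambda>U. X closure_of U) ` \<U>"
    and "inj_on (\<lambda>U. X closure_of U) \<U>"
proof -
  have sub: "U \<subseteq> topspace X" if "U \<in> \<U>" for U using op[OF that] openin_subset by blast
  have ne: "U \<noteq> {}" if "U \<in> \<U>" for U
    using irr[OF that] sub[OF that] by (simp add: irreducible_space_subtopology)
  have incl: "U = V" if "U \<in> \<U>" "V \<in> \<U>" "X closure_of U \<subseteq> X closure_of V" for U V
  proof -
    have "U \<subseteq> X closure_of V" using that closure_of_subset[OF sub] by blast
    then have "U \<inter> V \<noteq> {}" using ne[OF that(1)] openin_Int_closure_of_eq_empty[OF op[OF that(1)], of V] by blast
    then show ?thesis using disj that by blast
  qed
  show "inj_on (\<lambda>U. X closure_of U) \<U>" by (rule inj_onI) (rule incl, simp_all)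
  have clirr: "irreducible_space (subtopology X (X closure_of U))" if U: "U \<in> \<U>" for U
  proof (subst irreducible_space_subtopology[OF closure_of_subset_topspace], intro conjI allI impI; (elim conjE)?)
    show "X closure_of U \<noteq> {}" using ne[OF U] closure_of_subset[OF sub[OF U]] by blast
    fix A B assume AB: "closedin X A" "closedin X B" "X closure_of U \<subseteq> A \<union> B"
    then have "U \<subseteq> A \<union> B" using closure_of_subset[OF sub[OF U]] by blast
    then have "U \<subseteq> A \<or> U \<subseteq> B"
      using irr[OF U] AB(1,2) unfolding irreducible_space_subtopology[OF sub[OF U]] by simp
    then show "X closure_of U \<subseteq> A \<or> X closure_of U \<subseteq> B" using AB(1,2) closure_of_minimal by metis
  qed
  have into: "\<exists>U\<in>\<U>. D \<subseteq> X closure_of U" if D: "D \<subseteq> topspace X" "irreducible_space (subtopology X D)" for D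
  proof -
    have D': "D \<noteq> {}" "\<And>A B. closedin X A \<Longrightarrow> closedin X B \<Longrightarrow> D \<subseteq> A \<union> B \<Longrightarrow> D \<subseteq> A \<or> D \<subseteq> B"
      using D by (auto simp: irreducible_space_subtopology)
    have "\<exists>U\<in>\<V>. D \<subseteq> X closure_of U" if "finite \<V>" "D \<subseteq> (\<Union>U\<in>\<V>. X closure_of U)" for \<V>
      using that
    proof (induction \<V>)
      case empty then show ?case using D'(1) by simp
    next
      case (insert V \<V>)
      have "closedin X (\<Union>U\<in>\<V>. X closure_of U)" using insert.hyps by (intro closedin_Union) auto
      then show ?case using D'(2)[of "X closure_of V" "\<Union>U\<in>\<V>. X closure_of U"] insert by auto
    qed
    then show ?thesis using fin cover D(1) by blast
  qed
  show "irreducible_components X = (\<lambda>U. X closure_of U) ` \<U>"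
  proof (intro set_eqI iffI)
    fix C assume "C \<in> irreducible_components X"
    then have C: "C \<subseteq> topspace X" "irreducible_space (subtopology X C)"
      "\<And>D. D \<subseteq> topspace X \<Longrightarrow> irreducible_space (subtopology X D) \<Longrightarrow> C \<subseteq> D \<Longrightarrow> D = C"
      unfolding irreducible_components_def by auto
    obtain U where "U \<in> \<U>" "C \<subseteq> X closure_of U" using into C(1,2) by blast
    then have "X closure_of U = C" by (intro C(3) clirr closure_of_subset_topspace)
    then show "C \<in> (\<lambda>U. X closure_of U) ` \<U>" using \<open>U \<in> \<U>\<close> by blast
  next
    fix C assume "C \<in> (\<lambda>U. X closure_of U) ` \<U>"
    then obtain U where U: "U \<in> \<U>" "C = X closure_of U" by blast
    have "D = C" if D: "D \<subseteq> topspace X" "irreducible_space (subtopology X D)" "C \<subseteq> D" for D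
    proof -
      obtain V where V: "V \<in> \<U>" "D \<subseteq> X closure_of V" using into D by blast
      then have "U = V" using D(3) U by (intro incl) simp_all
      then show ?thesis using V(2) U(2) D(3) by simp
    qed
    then show "C \<in> irreducible_components X"
      unfolding irreducible_components_def U(2)
      using clirr[OF U(1)] closure_of_subset_topspace[of X U] U(2) by simp
  qed
qed

section \<open>Nilpotent Jordan superalgebras with one-dimensional even part\<close>

definition gvec :: "complex \<Rightarrow> complex^'n \<Rightarrow> (1, 'n::finite) gspace" where
  "gvec a u = (\<chi> s. case s of Inl _ \<Rightarrow> a | Inr j \<Rightarrow> u $ j)"

definition even_square :: "(1, 'n::finite) sconst \<Rightarrow> complex" where
  "even_square A = A $ Inl (1, 1, 1)"

definition left_op :: "(1, 'n::finite) sconst \<Rightarrow> complex^'n \<Rightarrow> complex^'n" where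
  "left_op A u = (\<chi> k. \<Sum>j\<in>UNIV. u $ j * A $ Inr (Inl (1, j, k)))"

definition odd_form :: "(1, 'n::finite) sconst \<Rightarrow> complex^'n \<Rightarrow> complex^'n \<Rightarrow> complex" where
  "odd_form A u v = (\<Sum>i\<in>UNIV. \<Sum>j\<in>UNIV. u $ i * v $ j * A $ Inr (Inr (i, j, 1)))"

lemma gvec_nth [simp]: "gvec a u $ Inl i = a" "gvec a u $ Inr j = u $ j"
  by (simp_all add: gvec_def)

lemma gvec_eq_iff [simp]: "gvec a u = gvec b v \<longleftrightarrow> a = b \<and> u = v"
  by (auto simp: gspace_eq_iff vec_eq_iff)

lemma gvec_cases: obtains a u where "v = gvec a u"
proof
  show "v = gvec (v $ Inl 1) (\<chi> j. v $ Inr j)" by (simp add: gspace_eq_iff)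
qed

lemma gvec_arith:
  "gvec a u + gvec b v = gvec (a + b) (u + v)" "gvec a u - gvec b v = gvec (a - b) (u - v)"
  "r *s gvec a u = gvec (r * a) (r *s u)" "0 = gvec 0 0"
  by (simp_all add: gspace_eq_iff)

lemma gvec_in_hpart:
  "gvec a u \<in> hpart 0 \<longleftrightarrow> u = 0" "gvec a u \<in> hpart 1 \<longleftrightarrow> a = 0"
  by (auto simp: hpart_def vec_eq_iff)

lemma left_op_linear:
  "left_op A (u + v) = left_op A u + left_op A v" "left_op A (r *s u) = r *s left_op A u"
  "left_op A (u - v) = left_op A u - left_op A v" "left_op A (- u) = - left_op A u"
  "left_op A 0 = 0"
  by (simp_all add: left_op_def vec_eq_iff algebra_simps sum.distrib sum_distrib_left sum_subtractf sum_negf)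

lemma odd_form_bilinear:
  "odd_form A (u + v) w = odd_form A u w + odd_form A v w"
  "odd_form A w (u + v) = odd_form A w u + odd_form A w v"
  "odd_form A (u - v) w = odd_form A u w - odd_form A v w"
  "odd_form A w (u - v) = odd_form A w u - odd_form A w v"
  "odd_form A (r *s u) w = r * odd_form A u w" "odd_form A w (r *s u) = r * odd_form A w u"
  "odd_form A 0 w = 0" "odd_form A w 0 = 0"
  by (simp_all add: odd_form_def algebra_simps sum.distrib sum_distrib_left sum_subtractf)

lemma mult_of_gvec:
  "mult_of A (gvec a u) (gvec b v) =
     gvec (a * b * even_square A + odd_form A u v) (a *s left_op A v + b *s left_op A u)"
  by (simp add: gspace_eq_iff mult_of_Inl mult_of_Inr even_square_def left_op_def odd_form_def
      algebra_simps sum.distrib sum_distrib_left)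

lemma block_map_gvec: "block_map P Q (gvec a u) = gvec (P $ 1 $ 1 * a) (Q *v u)"
  by (simp add: gspace_eq_iff block_map_Inl block_map_Inr matrix_vector_mult_def)

lemma alg_power_mult:
  assumes "x \<in> alg_power mul k" "y \<in> alg_power mul l" "1 \<le> k" "1 \<le> l"
  shows "mul x y \<in> alg_power mul (k + l)"
proof -
  have "mul x y \<in> (\<Union>i\<in>{1..<k+l}. (\<lambda>(x, y). mul x y) ` (alg_power mul (k + l - i) \<times> alg_power mul i))"
    using assms by (intro UN_I[of l] image_eqI[of _ _ "(x, y)"]) auto
  then show ?thesis
    using assms(3,4) by (subst alg_power.simps) (simp add: vec.span_base)
qed

lemma alg_power_scale:
  assumes "v \<in> alg_power mul k" shows "r *s v \<in> alg_power mul k"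
  using assms by (subst (asm) alg_power.simps, subst alg_power.simps) (auto intro: vec.span_scale)

text \<open>
  By induction on the exponent, such a set \<open>S\<close> is contained in every power of the algebra.
\<close>

lemma not_nilpotent_if_self_reproducing:
  assumes rep: "\<And>v. v \<in> S \<Longrightarrow> \<exists>r x y. v = r *s mul x y \<and> (x \<in> S \<or> y \<in> S)"
    and u: "u \<in> S" "u \<noteq> 0"
  shows "\<not> nilpotent_alg mul"
proof -
  have "S \<subseteq> alg_power mul k" if "1 \<le> k" for k
    using that
  proof (induction k rule: dec_induct)
    case base show ?case by (subst alg_power.simps) simp
  next
    case (step k)
    show ?case
    proof
      fix v assume "v \<in> S"
      then obtain r x y where v: "v = r *s mul x y" and xy: "x \<in> S \<or> y \<in> S" using rep by blast
      have one: "z \<in> alg_power mul 1" for z by (subst alg_power.simps) simp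
      from xy have "mul x y \<in> alg_power mul (Suc k)"
      proof
        assume "x \<in> S"
        then show ?thesis using alg_power_mult[of x mul k y 1] one step by auto
      next
        assume "y \<in> S"
        then show ?thesis using alg_power_mult[of x mul 1 y k] one step by auto
      qed
      then show "v \<in> alg_power mul (Suc k)" unfolding v by (rule alg_power_scale)
    qed
  qed
  then show ?thesis unfolding nilpotent_alg_def using u by blast
qed

text \<open>
  Powers are generated by products of lower powers, so any multiplicative filtration by subspaces
  starting from the whole algebra contains them. The bound \<open>N\<close> allows a filtration to be specified in
  finitely many degrees only.
\<close>

lemma alg_power_subset_filtration:
  assumes F1: "F 1 = UNIV"
    and sub: "\<And>k. vec.subspace (F k)"
    and mult: "\<And>i j x y. 1 \<le> i \<Longrightarrow> 1 \<le> j \<Longrightarrow> i + j \<le> N \<Longrightarrow> x \<in> F i \<Longrightarrow> y \<in> F j \<Longrightarrow> mul x y \<in> F (i + j)"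
    and k: "1 \<le> k" "k \<le> N"
  shows "alg_power mul k \<subseteq> F k"
  using k
proof (induction k rule: less_induct)
  case (less k)
  show ?case
  proof (cases "k = 1")
    case True then show ?thesis using F1 by simp
  next
    case False
    have "(\<lambda>(x, y). mul x y) ` (alg_power mul (k - i) \<times> alg_power mul i) \<subseteq> F k" if i: "i \<in> {1..<k}" for i
    proof clarify
      fix x y assume "x \<in> alg_power mul (k - i)" "y \<in> alg_power mul i"
      moreover have "alg_power mul (k - i) \<subseteq> F (k - i)" "alg_power mul i \<subseteq> F i"
        using i less.prems by (intro less.IH; auto)+
      ultimately have "mul x y \<in> F (k - i + i)"
        using i less.prems by (intro mult) auto
      then show "mul x y \<in> F k" using i by simp
    qed
    then have "vec.span (\<Union>i\<in>{1..<k}. (\<lambda>(x, y). mul x y) ` (alg_power mul (k - i) \<times> alg_power mul i)) \<subseteq> F k"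
      by (intro vec.span_minimal sub UN_least)
    then show ?thesis
      using False less.prems by (subst alg_power.simps) simp
  qed
qed

text \<open>
  The powers shrink in steps: the odd part falls into the image of \<open>L\<close> in degree 2, the even part
  disappears in degree 3 because \<open>W\<close> vanishes on the image of \<open>L\<close>, the odd part falls into the image of
  \<open>L\<^sup>2\<close> in degree 4, and everything is zero in degree 6 because \<open>L\<^sup>3 = 0\<close>.
\<close>

lemma nilpotent_mult_of:
  fixes A :: "(1, 'n::finite) sconst"
  assumes c: "even_square A = 0"
    and WL: "\<And>u v. odd_form A u (left_op A v) = 0" "\<And>u v. odd_form A (left_op A u) v = 0"
    and L3: "\<And>u. left_op A (left_op A (left_op A u)) = 0"
  shows "nilpotent_alg (mult_of A)"
proof -
  let ?L = "left_op A"
  define F where "F k = {v. \<exists>a u. v = gvec a u \<and> (2 \<le> k \<longrightarrow> (\<exists>w. u = ?L w)) \<and> (3 \<le> k \<longrightarrow> a = 0) \<and>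
      (4 \<le> k \<longrightarrow> (\<exists>w. u = ?L (?L w))) \<and> (6 \<le> k \<longrightarrow> u = 0)}" for k :: nat
  have F: "gvec a u \<in> F k \<longleftrightarrow> (2 \<le> k \<longrightarrow> (\<exists>w. u = ?L w)) \<and> (3 \<le> k \<longrightarrow> a = 0) \<and>
      (4 \<le> k \<longrightarrow> (\<exists>w. u = ?L (?L w))) \<and> (6 \<le> k \<longrightarrow> u = 0)" for a u k
    unfolding F_def by auto
  have "vec.subspace (F k)" for k
  proof (rule vec.subspaceI)
    show "0 \<in> F k" unfolding gvec_arith(4) F by (auto intro!: exI[of _ 0] simp: left_op_linear)
    fix x y r assume x: "x \<in> F k" and y: "y \<in> F k"
    obtain a u b v where xy: "x = gvec a u" "y = gvec b v" by (metis gvec_cases)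
    show "x + y \<in> F k" using x y unfolding xy gvec_arith F by (auto simp flip: left_op_linear)
    show "r *s x \<in> F k" using x unfolding xy gvec_arith F by (auto simp flip: left_op_linear)
  qed
  moreover have "F 1 = UNIV" unfolding F_def by (auto intro: gvec_cases)
  moreover have "mult_of A x y \<in> F (i + j)"
    if ij: "1 \<le> i" "1 \<le> j" "i + j \<le> 6" and x: "x \<in> F i" and y: "y \<in> F j" for i j x y
  proof -
    obtain a u b v where xy: "x = gvec a u" "y = gvec b v" by (metis gvec_cases)
    have x': "2 \<le> i \<Longrightarrow> \<exists>w. u = ?L w" "3 \<le> i \<Longrightarrow> a = 0" "4 \<le> i \<Longrightarrow> \<exists>w. u = ?L (?L w)"
      and y': "2 \<le> j \<Longrightarrow> \<exists>w. v = ?L w" "3 \<le> j \<Longrightarrow> b = 0" "4 \<le> j \<Longrightarrow> \<exists>w. v = ?L (?L w)"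
      using x y by (auto simp: xy F)
    have "a *s ?L v + b *s ?L u = ?L (a *s v + b *s u)" by (simp add: left_op_linear)
    moreover have "odd_form A u v = 0" if "3 \<le> i + j"
    proof -
      have "2 \<le> i \<or> 2 \<le> j" using that by auto
      then show ?thesis using x'(1) y'(1) WL by auto
    qed
    moreover have "\<exists>w. a *s ?L v + b *s ?L u = ?L (?L w)" if "4 \<le> i + j"
    proof -
      have "2 \<le> i \<and> 2 \<le> j \<or> 3 \<le> i \<or> 3 \<le> j" using that by presburger
      then consider "2 \<le> i" "2 \<le> j" | "3 \<le> i" | "3 \<le> j" by blast
      then show ?thesis
      proof cases
        case 1
        then obtain u' v' where "u = ?L u'" "v = ?L v'" using x'(1) y'(1) by blast
        then show ?thesis by (intro exI[of _ "a *s v' + b *s u'"]) (simp add: left_op_linear)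
      next
        case 2
        then obtain u' where "u = ?L u'" "a = 0" using x'(1,2) by force
        then show ?thesis by (intro exI[of _ "b *s u'"]) (simp add: left_op_linear)
      next
        case 3
        then obtain v' where "v = ?L v'" "b = 0" using y'(1,2) by force
        then show ?thesis by (intro exI[of _ "a *s v'"]) (simp add: left_op_linear)
      qed
    qed
    moreover have "a *s ?L v + b *s ?L u = 0" if "6 \<le> i + j"
    proof -
      have "3 \<le> i \<and> 3 \<le> j \<or> 4 \<le> i \<or> 4 \<le> j" using that by presburger
      then consider "3 \<le> i" "3 \<le> j" | "4 \<le> i" | "4 \<le> j" by blast
      then show ?thesis
      proof cases
        case 1 then show ?thesis using x'(2) y'(2) by simp
      next
        case 2
        then obtain u' where "u = ?L (?L u')" "a = 0" using x'(2,3) by force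
        then show ?thesis by (simp add: L3)
      next
        case 3
        then obtain v' where "v = ?L (?L v')" "b = 0" using y'(2,3) by force
        then show ?thesis by (simp add: L3)
      qed
    qed
    ultimately show ?thesis unfolding xy mult_of_gvec F c by auto
  qed
  ultimately have "alg_power (mult_of A) 6 \<subseteq> F 6"
    by (intro alg_power_subset_filtration[where N = 6]) auto
  also have "F 6 \<subseteq> {0}" unfolding F_def gvec_arith(4) by auto
  finally have "alg_power (mult_of A) 6 \<subseteq> {0}" .
  moreover have "0 \<in> alg_power (mult_of A) 6" by (subst alg_power.simps) (simp add: vec.span_zero)
  ultimately show ?thesis unfolding nilpotent_alg_def by (intro exI[of _ 6]) auto
qed

definition NJS_equations :: "(1, 'n::finite) sconst \<Rightarrow> bool" where
  "NJS_equations A \<longleftrightarrow> even_square A = 0 \<and>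
     (\<forall>u v. odd_form A u v + odd_form A v u = 0) \<and>
     (\<forall>u v. odd_form A u (left_op A v) = 0) \<and>
     (\<forall>u. left_op A (left_op A (left_op A u)) = 0) \<and>
     (\<forall>u v w. odd_form A u v *s left_op A (left_op A w) = 0)"

lemma NJS_equationsD:
  assumes "NJS_equations A"
  shows "even_square A = 0" "odd_form A u v = - odd_form A v u" "odd_form A u (left_op A v) = 0"
    "odd_form A (left_op A v) u = 0" "left_op A (left_op A (left_op A u)) = 0"
    "odd_form A u v *s left_op A (left_op A w) = 0" "odd_form A u u = 0"
proof -
  note * = assms[unfolded NJS_equations_def]
  show skew: "odd_form A u v = - odd_form A v u" for u v using * by (simp add: eq_neg_iff_add_eq_0)
  show WL: "odd_form A u (left_op A v) = 0" for u using * by blast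
  show "odd_form A (left_op A v) u = 0" using skew[of "left_op A v" u] WL[of u] by simp
  show "odd_form A u u = 0" using skew[of u u] by simp
qed (use assms[unfolded NJS_equations_def] in blast)+

text \<open>
  Under these equations both kinds of products that occur in the Jordan superidentity vanish
  individually: every term of their coordinates contains \<open>c\<close>, a value of \<open>W\<close> on the image of \<open>L\<close>,
  \<open>L\<^sup>3\<close> or a product of a value of \<open>W\<close> with \<open>L\<^sup>2\<close>.
\<close>

lemma NJS_if_equations:
  assumes A: "NJS_equations A" shows "A \<in> NJS"
proof -
  note D = NJS_equationsD[OF A]
  have W_or_L2: "(\<forall>u v. odd_form A u v = 0) \<or> (\<forall>u. left_op A (left_op A u) = 0)"
    using D(6) by (auto simp: vec.scale_eq_0_iff)
  have 1: "mult_of A (mult_of A w x) (mult_of A y z) = 0" for w x y z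
  proof -
    obtain a t b u c v d r where "w = gvec a t" "x = gvec b u" "y = gvec c v" "z = gvec d r" by (metis gvec_cases)
    then show ?thesis
      using W_or_L2 by (auto simp: mult_of_gvec left_op_linear odd_form_bilinear D(1,3,4) gvec_arith(4))
  qed
  have 2: "mult_of A x (mult_of A w (mult_of A y z)) = 0" for w x y z
  proof -
    obtain a t b u c v d r where "w = gvec a t" "x = gvec b u" "y = gvec c v" "z = gvec d r" by (metis gvec_cases)
    then show ?thesis
      using W_or_L2 by (auto simp: mult_of_gvec left_op_linear odd_form_bilinear D(1,3,4,5) gvec_arith(4))
  qed
  have "jordan_superidentity (mult_of A)"
    unfolding jordan_superidentity_def 1 2 by simp
  moreover have "supercommutative (mult_of A)"
    unfolding supercommutative_def
  proof (intro ballI)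
    fix b c :: nat and x y :: "(1, 'a) gspace"
    assume bc: "b \<in> {0,1}" "c \<in> {0,1}" and x: "x \<in> hpart b" and y: "y \<in> hpart c"
    obtain a u a' v where xy: "x = gvec a u" "y = gvec a' v" by (metis gvec_cases)
    show "mult_of A x y = (- 1) ^ (b * c) *s mult_of A y x"
      using bc x y D(2)[of u v]
      by (auto simp: xy gvec_in_hpart[simplified] mult_of_gvec gvec_arith D(1) odd_form_bilinear left_op_linear)
  qed
  moreover have "nilpotent_alg (mult_of A)"
    by (rule nilpotent_mult_of) (rule D)+
  ultimately show ?thesis
    by (simp add: NJS_def jordan_superalgebra_def superalgebra_mult_of)
qed

text \<open>
  If \<open>c \<noteq> 0\<close>, then \<open>e\<close> is a multiple of \<open>e e\<close>; if \<open>W(u, L v) \<noteq> 0\<close>, then \<open>e\<close> is a multiple of \<open>u (L v)\<close>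
  and \<open>L v = e v\<close>. In both cases a self-reproducing set contradicts nilpotency. Supercommutativity
  makes \<open>W\<close> alternating, and the remaining equations come from the Jordan superidentity at suitable
  homogeneous vectors.
\<close>

lemma NJS_imp_equations:
  fixes A :: "(1, 'n::finite) sconst"
  assumes "A \<in> NJS" shows "NJS_equations A"
proof -
  let ?L = "left_op A" and ?W = "odd_form A"
  have nil: "nilpotent_alg (mult_of A)" and com: "supercommutative (mult_of A)"
    and jor: "jordan_superidentity (mult_of A)"
    using assms by (auto simp: NJS_def jordan_superalgebra_def)
  have c: "even_square A = 0"
  proof (rule ccontr)
    assume "even_square A \<noteq> 0"
    then have "gvec 1 0 = inverse (even_square A) *s mult_of A (gvec 1 0) (gvec 1 0)"
      by (simp add: mult_of_gvec gvec_arith odd_form_bilinear left_op_linear)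
    then have "\<not> nilpotent_alg (mult_of A)"
      by (intro not_nilpotent_if_self_reproducing[of "{gvec 1 0}" _ "gvec 1 0"]) (auto simp: gvec_arith(4))
    with nil show False by simp
  qed
  have skew: "?W u v = - ?W v u" for u v
  proof -
    have "mult_of A (gvec 0 u) (gvec 0 v) = (-1) ^ (1 * 1) *s mult_of A (gvec 0 v) (gvec 0 u)"
      using com unfolding supercommutative_def by (metis gvec_in_hpart(2) insertCI)
    then show ?thesis by (simp add: mult_of_gvec gvec_arith)
  qed
  have WL: "?W u (?L v) = 0" for u v
  proof (rule ccontr)
    assume nz: "?W u (?L v) \<noteq> 0"
    have "gvec 1 0 = inverse (?W u (?L v)) *s mult_of A (gvec 0 u) (gvec 0 (?L v))"
      "gvec 0 (?L v) = 1 *s mult_of A (gvec 1 0) (gvec 0 v)"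
      using nz by (simp_all add: mult_of_gvec gvec_arith odd_form_bilinear left_op_linear)
    then have "\<exists>r x y. w = r *s mult_of A x y \<and> (x \<in> {gvec 1 0, gvec 0 (?L v)} \<or> y \<in> {gvec 1 0, gvec 0 (?L v)})"
      if "w \<in> {gvec 1 0, gvec 0 (?L v)}" for w
      using that by (metis insertCI insertE singletonD)
    then have "\<not> nilpotent_alg (mult_of A)"
      by (rule not_nilpotent_if_self_reproducing[of _ _ "gvec 1 0"]) (auto simp: gvec_arith(4))
    with nil show False by simp
  qed
  have LW: "?W (?L v) u = 0" for u v using skew[of "?L v" u] WL[of u v] by simp
  have diag: "?W u u = 0" for u using skew[of u u] by simp
  have e: "gvec 1 0 \<in> hpart 0" and f: "gvec 0 u \<in> hpart 1" for u :: "complex^'n"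
    by (auto simp: hpart_def)
  have J: "a \<in> {0,1} \<Longrightarrow> b \<in> {0,1} \<Longrightarrow> c \<in> {0,1} \<Longrightarrow> d \<in> {0,1} \<Longrightarrow>
      w \<in> hpart a \<Longrightarrow> x \<in> hpart b \<Longrightarrow> y \<in> hpart c \<Longrightarrow> z \<in> hpart d \<Longrightarrow>
        mult_of A (mult_of A w x) (mult_of A y z)
        + (-1) ^ (b * c) *s mult_of A (mult_of A w y) (mult_of A x z)
        + (-1) ^ ((b + c) * d) *s mult_of A (mult_of A w z) (mult_of A x y)
        - (-1) ^ (a * b) *s mult_of A x (mult_of A w (mult_of A y z))
        - (-1) ^ (c * (a + b)) *s mult_of A y (mult_of A w (mult_of A x z))
        - (-1) ^ (d * (a + b + c)) *s mult_of A z (mult_of A w (mult_of A x y)) = 0" for a b c d w x y z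
    using jor unfolding jordan_superidentity_def by blast
  have L3: "?L (?L (?L u)) = 0" for u
  proof -
    have "gvec 0 (?L (?L (?L u)) + ?L (?L (?L u))) = gvec 0 0"
      using J[of 0 0 0 1, OF _ _ _ _ e e e f[of u]]
      by (simp add: mult_of_gvec c odd_form_bilinear left_op_linear gvec_arith)
    then have "(?L (?L (?L u)) + ?L (?L (?L u))) $ i = 0" for i by (simp only: gvec_eq_iff) simp
    then show ?thesis by (simp add: vec_eq_iff flip: mult_2)
  qed
  have key: "?W u v *s ?L (?L w) = ?W u w *s ?L (?L v)" for u v w
    using J[of 1 1 1 0, OF _ _ _ _ f[of u] f[of v] f[of w] e]
    by (simp add: mult_of_gvec c odd_form_bilinear left_op_linear gvec_arith WL LW)
  have "?W u v *s ?L (?L w) = 0" for u v w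
  proof (cases "?W u v = 0")
    case False
    have "?W u v *s ?L (?L v) = 0"
    proof -
      have "?W v u *s ?L (?L v) = 0" using key[of v v u] diag[of v] by simp
      then show ?thesis using skew[of u v] by simp
    qed
    then have "?L (?L v) = 0" using False by (simp add: vec.scale_eq_0_iff)
    then show ?thesis using key[of u v w] by simp
  qed simp
  then show ?thesis
    unfolding NJS_equations_def using c skew[unfolded eq_neg_iff_add_eq_0] WL L3 by blast
qed

lemma NJS_iff_equations: "A \<in> NJS \<longleftrightarrow> NJS_equations A"
  using NJS_if_equations NJS_imp_equations by blast

lemma poly_functions_sum: "(\<And>i. i \<in> I \<Longrightarrow> p i \<in> poly_functions) \<Longrightarrow> (\<lambda>x. \<Sum>i\<in>I. p i x) \<in> poly_functions"
  by (induction I rule: infinite_finite_induct) (auto intro: poly_functions.intros)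

lemma poly_functions_diff:
  assumes "p \<in> poly_functions" "q \<in> poly_functions" shows "(\<lambda>x. p x - q x) \<in> poly_functions"
  using poly_functions.add[OF assms(1) poly_functions.mult[OF poly_functions.const[of "-1"] assms(2)]] by simp

lemma poly_functions_left_op:
  "(\<And>j. (\<lambda>A. u A $ j) \<in> poly_functions) \<Longrightarrow> (\<lambda>A. left_op A (u A) $ k) \<in> poly_functions"
  by (simp add: left_op_def) (intro poly_functions_sum poly_functions.mult poly_functions.coord)

lemma poly_functions_odd_form:
  "(\<And>j. (\<lambda>A. u A $ j) \<in> poly_functions) \<Longrightarrow> (\<And>j. (\<lambda>A. v A $ j) \<in> poly_functions) \<Longrightarrow>
   (\<lambda>A. odd_form A (u A) (v A)) \<in> poly_functions"
  unfolding odd_form_def by (intro poly_functions_sum poly_functions.mult poly_functions.coord)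

lemmas poly_functions_intros = poly_functions.const poly_functions.add poly_functions_diff poly_functions.mult
  poly_functions_left_op poly_functions_odd_form

lemma closedin_zariski_zeros: "p \<in> poly_functions \<Longrightarrow> closedin zariski {x. p x = 0}"
  unfolding closedin_zariski by (intro exI[of _ "{p}"]) (auto simp: zero_set_def)

lemma closedin_zariski_conj:
  "closedin zariski {x. P x} \<Longrightarrow> closedin zariski {x. Q x} \<Longrightarrow> closedin zariski {x. P x \<and> Q x}"
  using closedin_Int[of zariski "{x. P x}" "{x. Q x}"] by (simp add: Int_def)

lemma closedin_zariski_all:
  assumes "\<And>i. closedin zariski {x. P i x}" shows "closedin zariski {x. \<forall>i. P i x}"
proof -
  have "closedin zariski (\<Inter>i. {x. P i x})" using assms by (intro closedin_Inter) auto
  moreover have "(\<Inter>i. {x. P i x}) = {x. \<forall>i. P i x}" by auto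
  ultimately show ?thesis by simp
qed

lemma closedin_NJS: "closedin zariski (NJS :: (1, 'n::finite) sconst set)"
proof -
  have "closedin zariski {A :: (1, 'n) sconst. NJS_equations A}"
    unfolding NJS_equations_def vec_eq_iff even_square_def vector_smult_component zero_index
    by (intro closedin_zariski_conj closedin_zariski_all closedin_zariski_zeros
        poly_functions_intros poly_functions.coord)
  moreover have "{A :: (1, 'n) sconst. NJS_equations A} = NJS" using NJS_iff_equations by blast
  ultimately show ?thesis by simp
qed

lemma orbitE_1n:
  fixes A B :: "(1, 'n::finite) sconst"
  assumes "B \<in> orbit A"
  obtains p Q where "p \<noteq> 0" "invertible Q" "p * even_square A = p * p * even_square B"
    "\<And>u. Q *v left_op A u = p *s left_op B (Q *v u)"
    "\<And>u v. p * odd_form A u v = odd_form B (Q *v u) (Q *v v)"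
proof -
  obtain P :: "complex^1^1" and Q where PQ: "invertible P" "invertible Q"
     "\<And>x y. block_map P Q (mult_of A x y) = mult_of B (block_map P Q x) (block_map P Q y)"
    using assms unfolding orbit_iff_block_map by blast
  note b = block_map_gvec[of P Q]
  show ?thesis
  proof
    show "P $ 1 $ 1 \<noteq> 0" using PQ(1) by (simp add: invertible_det_nz det_1)
    show "P $ 1 $ 1 * even_square A = P $ 1 $ 1 * P $ 1 $ 1 * even_square B"
      using PQ(3)[of "gvec 1 0" "gvec 1 0"] by (simp add: mult_of_gvec b odd_form_bilinear)
    show "Q *v left_op A u = P $ 1 $ 1 *s left_op B (Q *v u)" for u
      using PQ(3)[of "gvec 1 0" "gvec 0 u"] by (simp add: mult_of_gvec b odd_form_bilinear)
    show "P $ 1 $ 1 * odd_form A u v = odd_form B (Q *v u) (Q *v v)" for u v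
      using PQ(3)[of "gvec 0 u" "gvec 0 v"] by (simp add: mult_of_gvec b)
  qed (fact PQ)
qed

lemma orbitI_1n:
  fixes A B :: "(1, 'n::finite) sconst"
  assumes "invertible Q" "even_square A = even_square B"
    "\<And>u. Q *v left_op A u = left_op B (Q *v u)"
    "\<And>u v. odd_form A u v = odd_form B (Q *v u) (Q *v v)"
  shows "B \<in> orbit A"
proof -
  have b: "block_map (mat 1) Q (gvec a u) = gvec a (Q *v u)" for a u
    by (simp add: block_map_gvec mat_def)
  have "block_map (mat 1) Q (mult_of A x y) = mult_of B (block_map (mat 1) Q x) (block_map (mat 1) Q y)" for x y
    by (cases x rule: gvec_cases, cases y rule: gvec_cases)
       (simp add: mult_of_gvec b assms matrix_vector_right_distrib vector_scalar_commute)
  moreover have "invertible (mat 1 :: complex^1^1)" by (simp add: invertible_det_nz)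
  ultimately show ?thesis unfolding orbit_iff_block_map using assms(1) by blast
qed

lemma NJS_orbit:
  fixes A B :: "(1, 'n::finite) sconst"
  assumes A: "A \<in> NJS" and B: "B \<in> orbit A" shows "B \<in> NJS"
proof -
  have NA: "NJS_equations A" using A by (simp add: NJS_iff_equations)
  obtain p Q where p: "p \<noteq> 0" "invertible Q" and c: "p * even_square A = p * p * even_square B"
    and L: "\<And>u. Q *v left_op A u = p *s left_op B (Q *v u)"
    and W: "\<And>u v. p * odd_form A u v = odd_form B (Q *v u) (Q *v v)"
    using orbitE_1n[OF B] by metis
  note D = NJS_equationsD[OF NA]
  have surj: "\<exists>x. u = Q *v x" for u
    by (rule exI[of _ "matrix_inv Q *v u"]) (simp add: matrix_vector_mul_assoc matrix_inv_mult p)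
  have LB: "left_op B (Q *v u) = Q *v (inverse p *s left_op A u)" for u
    by (simp add: vector_scalar_commute L p)
  have "NJS_equations B"
    unfolding NJS_equations_def
  proof (intro conjI allI)
    show "even_square B = 0" using c p D(1) by simp
    fix u v w
    obtain x y z where [simp]: "u = Q *v x" "v = Q *v y" "w = Q *v z" using surj by metis
    show "odd_form B u v + odd_form B v u = 0" by (simp flip: W add: D(2)[of x y])
    show "odd_form B u (left_op B v) = 0" by (simp add: LB odd_form_bilinear D(3) flip: W)
    show "left_op B (left_op B (left_op B u)) = 0" by (simp add: LB left_op_linear D(5))
    show "odd_form B u v *s left_op B (left_op B w) = 0"
      using D(6)[of x y z] by (auto simp add: LB left_op_linear vector_scalar_commute vec.scale_eq_0_iff simp flip: W)
  qed
  then show ?thesis by (simp add: NJS_iff_equations)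
qed

section \<open>Normal forms in type (1,4)\<close>

text \<open>
  Linear independence is stated through coefficients, so that it concerns the ordered tuple and
  excludes repetitions; four such vectors are a basis.
\<close>

definition frame :: "complex^4 \<Rightarrow> complex^4 \<Rightarrow> complex^4 \<Rightarrow> complex^4 \<Rightarrow> bool" where
  "frame f1 f2 f3 f4 \<longleftrightarrow> (\<forall>a b c d. a *s f1 + b *s f2 + c *s f3 + d *s f4 = 0 \<longrightarrow> a = 0 \<and> b = 0 \<and> c = 0 \<and> d = 0)"

definition columns4 :: "complex^4 \<Rightarrow> complex^4 \<Rightarrow> complex^4 \<Rightarrow> complex^4 \<Rightarrow> complex^4^4" where
  "columns4 f1 f2 f3 f4 = (\<chi> i j. (if j = 1 then f1 else if j = 2 then f2 else if j = 3 then f3 else f4) $ i)"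

lemma columns4_mult: "columns4 f1 f2 f3 f4 *v x = x $ 1 *s f1 + x $ 2 *s f2 + x $ 3 *s f3 + x $ 4 *s f4"
  by (simp add: columns4_def matrix_vector_mult_def sum_4 vec_eq_iff mult.commute)

lemma frameD:
  "frame f1 f2 f3 f4 \<Longrightarrow> a *s f1 + b *s f2 + c *s f3 + d *s f4 = 0 \<Longrightarrow> a = 0 \<and> b = 0 \<and> c = 0 \<and> d = 0"
  unfolding frame_def by blast

lemma invertible_columns4:
  assumes "frame f1 f2 f3 f4" shows "invertible (columns4 f1 f2 f3 f4)"
  unfolding invertible_left_inverse matrix_left_invertible_ker columns4_mult
proof (intro allI impI)
  fix x :: "complex^4"
  assume "x $ 1 *s f1 + x $ 2 *s f2 + x $ 3 *s f3 + x $ 4 *s f4 = 0"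
  from frameD[OF assms this] show "x = 0" by (simp only: vec_eq_iff forall_4 zero_index)
qed

lemma frame_spans:
  assumes "frame f1 f2 f3 f4" obtains a b c d where "v = a *s f1 + b *s f2 + c *s f3 + d *s f4"
proof -
  let ?Q = "columns4 f1 f2 f3 f4"
  have "v = ?Q *v (matrix_inv ?Q *v v)"
    by (simp add: matrix_vector_mul_assoc matrix_inv_mult invertible_columns4 assms)
  then show ?thesis unfolding columns4_mult by (rule that)
qed

lemma vector_outside_span3: "\<exists>d :: complex^4. d \<notin> vec.span {a, b, c}"
proof (rule ccontr)
  assume "\<not> ?thesis"
  then have "vec.dim (UNIV :: (complex^4) set) \<le> card {a, b, c}"
    by (intro vec.dim_le_card) auto
  also have "\<dots> \<le> 3" by (simp add: card_insert_if)
  finally show False by (simp add: card_cart_basis)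
qed

lemma frame_extend3:
  assumes "\<And>a b c. a *s f1 + b *s f2 + c *s f3 = 0 \<Longrightarrow> a = 0 \<and> b = 0 \<and> c = 0"
  obtains f4 where "frame f1 f2 f3 f4"
proof -
  obtain f4 where f4: "f4 \<notin> vec.span {f1, f2, f3}" using vector_outside_span3 by blast
  have "a = 0 \<and> b = 0 \<and> c = 0 \<and> d = 0" if eq: "a *s f1 + b *s f2 + c *s f3 + d *s f4 = 0" for a b c d
  proof -
    have "d = 0"
    proof (rule ccontr)
      assume d: "d \<noteq> 0"
      have "f4 = (-a/d) *s f1 + (-b/d) *s f2 + (-c/d) *s f3"
      proof -
        have "d * f4 $ i = - (a * f1 $ i) - b * f2 $ i - c * f3 $ i" for i
          using arg_cong[OF eq, of "\<lambda>v. v $ i"] by (simp add: algebra_simps add_eq_0_iff)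
        then show ?thesis using d by (simp add: vec_eq_iff field_simps)
      qed
      also have "\<dots> \<in> vec.span {f1, f2, f3}"
        by (intro vec.span_add vec.span_scale vec.span_base) auto
      finally show False using f4 by simp
    qed
    then show ?thesis using eq assms[of a b c] by simp
  qed
  then have "frame f1 f2 f3 f4" unfolding frame_def by blast
  then show ?thesis by (rule that)
qed

lemma frame_extend2:
  assumes "\<And>a b. a *s f1 + b *s f2 = 0 \<Longrightarrow> a = 0 \<and> b = 0"
  obtains f3 f4 where "frame f1 f2 f3 f4"
proof -
  obtain f3 where f3: "f3 \<notin> vec.span {f1, f2, f2}" using vector_outside_span3 by blast
  have "a = 0 \<and> b = 0 \<and> c = 0" if eq: "a *s f1 + b *s f2 + c *s f3 = 0" for a b c
  proof -
    have "c = 0"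
    proof (rule ccontr)
      assume c: "c \<noteq> 0"
      have "f3 = (-a/c) *s f1 + (-b/c) *s f2"
      proof -
        have "c * f3 $ i = - (a * f1 $ i) - b * f2 $ i" for i
          using arg_cong[OF eq, of "\<lambda>v. v $ i"] by (simp add: algebra_simps add_eq_0_iff)
        then show ?thesis using c by (simp add: vec_eq_iff field_simps)
      qed
      also have "\<dots> \<in> vec.span {f1, f2, f2}"
        by (intro vec.span_add vec.span_scale vec.span_base) auto
      finally show False using f3 by simp
    qed
    then show ?thesis using eq assms[of a b] by simp
  qed
  then obtain f4 where "frame f1 f2 f3 f4" by (rule frame_extend3)
  then show ?thesis by (rule that)
qed

lemma table14_nth:
  "even_square (table14 E W) = 0"
  "left_op (table14 E W) u $ k = (\<Sum>j\<in>UNIV. u $ j * of_bool ((j, k) \<in> E))"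
  "odd_form (table14 E W) u v = (\<Sum>i\<in>UNIV. \<Sum>j\<in>UNIV. u $ i * v $ j * (of_bool ((i, j) \<in> W) - of_bool ((j, i) \<in> W)))"
  by (simp_all add: table14_def even_square_def left_op_def odd_form_def)

lemma left_op_J:
  "left_op J3 u = 0"
  "left_op J6 u = u $ 2 *s axis 1 1"
  "left_op J7 u = u $ 2 *s axis 1 1 + u $ 3 *s axis 2 1"
  "left_op J9 u = u $ 2 *s axis 1 1 + u $ 4 *s axis 3 1"
  by (simp_all add: vec_eq_iff forall_4 J3_def J6_def J7_def J9_def table14_nth sum_4 axis_def)

lemma odd_form_J:
  "odd_form J3 u v = u $ 1 * v $ 2 - u $ 2 * v $ 1 + u $ 3 * v $ 4 - u $ 4 * v $ 3"
  "odd_form J6 u v = u $ 3 * v $ 4 - u $ 4 * v $ 3"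
  "odd_form J7 u v = 0"
  "odd_form J9 u v = u $ 2 * v $ 4 - u $ 4 * v $ 2"
  by (simp_all add: J3_def J6_def J7_def J9_def table14_nth sum_4)

lemma even_square_J: "even_square J3 = 0" "even_square J6 = 0" "even_square J7 = 0" "even_square J9 = 0"
  by (simp_all add: J3_def J6_def J7_def J9_def table14_nth)

lemma J_in_NJS: "J3 \<in> NJS" "J6 \<in> NJS" "J7 \<in> NJS" "J9 \<in> NJS"
  unfolding NJS_iff_equations NJS_equations_def
  by (simp_all add: even_square_J left_op_J odd_form_J axis_def vec_eq_iff)

text \<open>
  Kept apart from the equations of the variety because the normal form of \<open>J9\<close> is also recognized on a
  line of structure constants whose points are not known beforehand to lie in the variety.
\<close>

definition skew_odd :: "(1, 'n::finite) sconst \<Rightarrow> bool" where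
  "skew_odd A \<longleftrightarrow> (\<forall>u v. odd_form A u v + odd_form A v u = 0)"

lemma skew_oddD: "skew_odd A \<Longrightarrow> odd_form A u v = - odd_form A v u"
  by (simp add: skew_odd_def eq_neg_iff_add_eq_0)

lemma skew_odd_if_equations: "NJS_equations A \<Longrightarrow> skew_odd A"
  by (simp add: skew_odd_def NJS_equations_def)

lemma odd_form_frame:
  assumes "skew_odd A"
  shows "odd_form A (a *s f1 + b *s f2 + c *s f3 + d *s f4) (a' *s f1 + b' *s f2 + c' *s f3 + d' *s f4) =
     (a * b' - b * a') * odd_form A f1 f2 + (a * c' - c * a') * odd_form A f1 f3 + (a * d' - d * a') * odd_form A f1 f4
   + (b * c' - c * b') * odd_form A f2 f3 + (b * d' - d * b') * odd_form A f2 f4 + (c * d' - d * c') * odd_form A f3 f4"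
proof -
  have diag: "odd_form A u u = 0" for u using skew_oddD[OF assms, of u u] by simp
  show ?thesis
    using skew_oddD[OF assms, of f2 f1] skew_oddD[OF assms, of f3 f1] skew_oddD[OF assms, of f4 f1]
      skew_oddD[OF assms, of f3 f2] skew_oddD[OF assms, of f4 f2] skew_oddD[OF assms, of f4 f3]
    by (simp add: odd_form_bilinear diag algebra_simps)
qed

lemma orbit_J3I:
  assumes "frame f1 f2 f3 f4" "even_square A = 0" "skew_odd A" "\<And>u. left_op A u = 0"
    "odd_form A f1 f2 = 1" "odd_form A f1 f3 = 0" "odd_form A f1 f4 = 0"
    "odd_form A f2 f3 = 0" "odd_form A f2 f4 = 0" "odd_form A f3 f4 = 1"
  shows "A \<in> orbit J3"
  by (rule orbitI_1n[of "columns4 f1 f2 f3 f4"])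
    (simp_all add: assms invertible_columns4 columns4_mult left_op_J even_square_J odd_form_J odd_form_frame)

lemma orbit_J6I:
  assumes "frame f1 f2 f3 f4" "even_square A = 0" "skew_odd A"
    "left_op A f1 = 0" "left_op A f2 = f1" "left_op A f3 = 0" "left_op A f4 = 0"
    "odd_form A f1 f2 = 0" "odd_form A f1 f3 = 0" "odd_form A f1 f4 = 0"
    "odd_form A f2 f3 = 0" "odd_form A f2 f4 = 0" "odd_form A f3 f4 = 1"
  shows "A \<in> orbit J6"
  by (rule orbitI_1n[of "columns4 f1 f2 f3 f4"])
    (simp_all add: assms invertible_columns4 columns4_mult left_op_J even_square_J odd_form_J odd_form_frame
      left_op_linear axis_def)

lemma orbit_J7I:
  assumes "frame f1 f2 f3 f4" "even_square A = 0" "\<And>u v. odd_form A u v = 0"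
    "left_op A f1 = 0" "left_op A f2 = f1" "left_op A f3 = f2" "left_op A f4 = 0"
  shows "A \<in> orbit J7"
  by (rule orbitI_1n[of "columns4 f1 f2 f3 f4"])
    (simp_all add: assms invertible_columns4 columns4_mult left_op_J even_square_J odd_form_J
      left_op_linear axis_def)

lemma orbit_J9I:
  assumes "frame f1 f2 f3 f4" "even_square A = 0" "skew_odd A"
    "left_op A f1 = 0" "left_op A f2 = f1" "left_op A f3 = 0" "left_op A f4 = f3"
    "odd_form A f1 f2 = 0" "odd_form A f1 f3 = 0" "odd_form A f1 f4 = 0"
    "odd_form A f2 f3 = 0" "odd_form A f2 f4 = 1" "odd_form A f3 f4 = 0"
  shows "A \<in> orbit J9"
  by (rule orbitI_1n[of "columns4 f1 f2 f3 f4"])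
    (simp_all add: assms invertible_columns4 columns4_mult left_op_J even_square_J odd_form_J odd_form_frame
      left_op_linear axis_def)

lemma frame_shear:
  assumes "frame f1 f2 f3 f4"
  shows "frame f1 f2 (f3 + a *s f1 + b *s f2) (f4 + c *s f1 + d *s f2 + e *s f3)"
  unfolding frame_def
proof (intro allI impI)
  fix p q r s
  assume "p *s f1 + q *s f2 + r *s (f3 + a *s f1 + b *s f2) + s *s (f4 + c *s f1 + d *s f2 + e *s f3) = 0"
  then have "(p + r * a + s * c) *s f1 + (q + r * b + s * d) *s f2 + (r + s * e) *s f3 + s *s f4 = 0"
    by (simp add: vec_eq_iff algebra_simps)
  from frameD[OF assms this] show "p = 0 \<and> q = 0 \<and> r = 0 \<and> s = 0" by auto
qed

lemma frame_permute:
  assumes "frame f1 f2 f3 f4" shows "frame f1 f2 f4 f3" "frame f1 f4 f2 f3" "frame f3 f1 f4 f2"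
proof -
  have "a *s f1 + b *s f2 + c *s f4 + d *s f3 = 0 \<Longrightarrow> a = 0 \<and> b = 0 \<and> c = 0 \<and> d = 0"
    "a *s f1 + b *s f4 + c *s f2 + d *s f3 = 0 \<Longrightarrow> a = 0 \<and> b = 0 \<and> c = 0 \<and> d = 0"
    "a *s f3 + b *s f1 + c *s f4 + d *s f2 = 0 \<Longrightarrow> a = 0 \<and> b = 0 \<and> c = 0 \<and> d = 0" for a b c d
    using frameD[OF assms, of a b d c] frameD[OF assms, of a c d b] frameD[OF assms, of b d a c]
    by (simp_all only: add_ac)
  then show "frame f1 f2 f4 f3" "frame f1 f4 f2 f3" "frame f3 f1 f4 f2"
    unfolding frame_def by blast+
qed

text \<open>
  A vector \<open>x\<close> with \<open>L\<^sup>2 x \<noteq> 0\<close> generates a Jordan block of size 3. Nilpotency of \<open>L\<close> allows a fourth basis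
  vector to be corrected by \<open>x\<close> and \<open>L x\<close> so that \<open>L\<close> kills it.
\<close>

lemma in_orbit_J7:
  assumes A: "NJS_equations A" and x: "left_op A (left_op A x) \<noteq> 0"
  shows "A \<in> orbit J7"
proof -
  let ?L = "left_op A"
  note D = NJS_equationsD[OF A]
  have W: "odd_form A u v = 0" for u v using D(6)[of u v x] x by (simp add: vec.scale_eq_0_iff)
  have "a = 0 \<and> b = 0 \<and> c = 0" if eq: "a *s ?L (?L x) + b *s ?L x + c *s x = 0" for a b c
  proof -
    have "?L (?L (a *s ?L (?L x) + b *s ?L x + c *s x)) = 0" by (simp only: eq left_op_linear)
    then have c: "c = 0" using x by (simp add: left_op_linear D(5) vec.scale_eq_0_iff)
    have "?L (a *s ?L (?L x) + b *s ?L x + c *s x) = 0" by (simp only: eq left_op_linear)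
    then have "b = 0" using x c by (simp add: left_op_linear D(5) vec.scale_eq_0_iff)
    then show ?thesis using c eq x by (simp add: vec.scale_eq_0_iff)
  qed
  then obtain y where fr: "frame (?L (?L x)) (?L x) x y" by (rule frame_extend3)
  obtain a b c d where Ly: "?L y = a *s ?L (?L x) + b *s ?L x + c *s x + d *s y"
    using fr by (rule frame_spans)
  (* The y-coefficient of L^3 y = 0 is d^3, and once d = 0 the remaining one is c. *)
  have "?L (?L (?L y)) = (c + d * b + d * d * a) *s ?L (?L x) + (d * c + d * d * b) *s ?L x + (d * d * c) *s x + (d * d * d) *s y"
  proof -
    have "?L (?L y) = b *s ?L (?L x) + c *s ?L x + d *s ?L y"
      by (simp add: Ly left_op_linear D(5))
    then have "?L (?L (?L y)) = c *s ?L (?L x) + d *s (b *s ?L (?L x) + c *s ?L x + d *s ?L y)"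
      by (simp add: left_op_linear D(5))
    then show ?thesis by (simp add: Ly vec_eq_iff algebra_simps)
  qed
  from frameD[OF fr this[unfolded D(5), symmetric]] have "d = 0" "c = 0" by auto
  then have 0: "?L (y + (- a) *s ?L x + (- b) *s x) = 0"
    by (simp add: Ly left_op_linear vec_eq_iff)
  have "frame (?L (?L x)) (?L x) x (y + (- a) *s ?L x + (- b) *s x)"
    using frame_shear[OF fr, of 0 0 0 "- a" "- b"] by simp
  then show ?thesis
    by (rule orbit_J7I) (simp_all only: D(1,5) W 0)
qed

text \<open>
  A hyperbolic pair is split off, and the remaining basis vectors are projected onto its orthogonal
  complement.
\<close>

lemma skew_frame:
  assumes sk: "skew_odd A" and nz: "odd_form A u v \<noteq> 0"
  obtains f1 f2 f3 f4 where "frame f1 f2 f3 f4" "odd_form A f1 f2 = 1" "odd_form A f1 f3 = 0"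
    "odd_form A f1 f4 = 0" "odd_form A f2 f3 = 0" "odd_form A f2 f4 = 0"
proof -
  let ?W = "odd_form A"
  have diag: "?W w w = 0" for w using skew_oddD[OF sk, of w w] by simp
  define f2 where "f2 = inverse (?W u v) *s v"
  have W12: "?W u f2 = 1" and W21: "?W f2 u = -1"
    using nz skew_oddD[OF sk, of v u] by (simp_all add: f2_def odd_form_bilinear)
  have "a = 0 \<and> b = 0" if eq: "a *s u + b *s f2 = 0" for a b
  proof -
    have "?W u (a *s u + b *s f2) = 0" "?W f2 (a *s u + b *s f2) = 0" by (simp_all only: eq odd_form_bilinear)
    then show ?thesis by (simp add: odd_form_bilinear diag W12 W21)
  qed
  then obtain g3 g4 where fr: "frame u f2 g3 g4" by (rule frame_extend2)
  have "frame u f2 (g3 + ?W f2 g3 *s u + (- ?W u g3) *s f2) (g4 + ?W f2 g4 *s u + (- ?W u g4) *s f2)"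
    using frame_shear[OF fr, of "?W f2 g3" "- ?W u g3" "?W f2 g4" "- ?W u g4" 0] by simp
  then show ?thesis
    by (rule that) (simp_all only: W12 W21 odd_form_bilinear diag, simp_all)
qed

text \<open>
  A nondegenerate \<open>W\<close> that vanishes on the image of \<open>L\<close> forces \<open>L = 0\<close>.
\<close>

lemma in_orbit_J3:
  assumes A: "NJS_equations A" and fr: "frame f1 f2 f3 f4"
    and W: "odd_form A f1 f2 = 1" "odd_form A f1 f3 = 0"
    "odd_form A f1 f4 = 0" "odd_form A f2 f3 = 0" "odd_form A f2 f4 = 0" and nz: "odd_form A f3 f4 \<noteq> 0"
  shows "A \<in> orbit J3"
proof -
  note D = NJS_equationsD[OF A]
  have sk: "skew_odd A" using A by (rule skew_odd_if_equations)
  have L: "left_op A v = 0" for v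
  proof -
    obtain a b c d where v: "left_op A v = a *s f1 + b *s f2 + c *s f3 + d *s f4" using fr by (rule frame_spans)
    have W': "odd_form A f2 f1 = -1" "odd_form A f3 f1 = 0" "odd_form A f3 f2 = 0" "odd_form A f4 f1 = 0" "odd_form A f4 f2 = 0"
      "odd_form A f4 f3 = - odd_form A f3 f4"
      using skew_oddD[OF sk, of f2 f1] skew_oddD[OF sk, of f3 f1] skew_oddD[OF sk, of f3 f2]
        skew_oddD[OF sk, of f4 f1] skew_oddD[OF sk, of f4 f2] skew_oddD[OF sk, of f4 f3] W by simp_all
    have "b = 0" using D(3)[of f1 v] unfolding v by (simp add: odd_form_bilinear W D(7))
    moreover have "a = 0" using D(3)[of f2 v] unfolding v by (simp add: odd_form_bilinear W W' D(7))
    moreover have "d = 0" using D(3)[of f3 v] nz unfolding v by (simp add: odd_form_bilinear W W' D(7))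
    moreover have "c = 0" using D(3)[of f4 v] nz unfolding v by (simp add: odd_form_bilinear W W' D(7))
    ultimately show ?thesis using v by simp
  qed
  have "frame f1 f2 f3 (inverse (odd_form A f3 f4) *s f4)"
    unfolding frame_def
  proof (intro allI impI)
    fix a b c d assume "a *s f1 + b *s f2 + c *s f3 + d *s (inverse (odd_form A f3 f4) *s f4) = 0"
    then have "a *s f1 + b *s f2 + c *s f3 + (d * inverse (odd_form A f3 f4)) *s f4 = 0" by simp
    from frameD[OF fr this] show "a = 0 \<and> b = 0 \<and> c = 0 \<and> d = 0" using nz by simp
  qed
  then show ?thesis
    by (rule orbit_J3I) (use nz in \<open>simp_all add: D(1) sk L W odd_form_bilinear\<close>)
qed

text \<open>
  The image of \<open>L\<close> is orthogonal to everything, in particular to the hyperbolic pair \<open>f\<^sub>1, f\<^sub>2\<close>.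
\<close>

lemma left_op_in_radical:
  assumes A: "NJS_equations A" and fr: "frame f1 f2 f3 f4"
    and W: "odd_form A f1 f2 = 1" "odd_form A f1 f3 = 0"
    "odd_form A f1 f4 = 0" "odd_form A f2 f3 = 0" "odd_form A f2 f4 = 0"
  obtains c d where "left_op A v = c *s f3 + d *s f4"
proof -
  note D = NJS_equationsD[OF A]
  obtain a b c d where v: "left_op A v = a *s f1 + b *s f2 + c *s f3 + d *s f4" using fr by (rule frame_spans)
  have "odd_form A f2 f1 = -1" using D(2)[of f2 f1] W by simp
  then have "a = 0" using D(3)[of f2 v] unfolding v by (simp add: odd_form_bilinear W D(7))
  moreover have "b = 0" using D(3)[of f1 v] unfolding v by (simp add: odd_form_bilinear W D(7))
  ultimately show ?thesis using v by (intro that) simp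
qed

text \<open>
  Since \<open>L\<^sup>2 = 0\<close> and \<open>L\<close> maps into the plane spanned by \<open>f\<^sub>3\<close> and \<open>f\<^sub>4\<close>, on which it is not zero, its image
  is the line spanned by \<open>L f\<^sub>3\<close>. Subtracting multiples of \<open>f\<^sub>3\<close> moves \<open>f\<^sub>1\<close> and \<open>f\<^sub>2\<close> into the kernel of
  \<open>L\<close> without changing \<open>W\<close>, because \<open>f\<^sub>3\<close> lies in its radical.
\<close>

lemma in_orbit_J6:
  assumes A: "NJS_equations A" and fr: "frame f1 f2 f3 f4"
    and W: "odd_form A f1 f2 = 1" "odd_form A f1 f3 = 0"
    "odd_form A f1 f4 = 0" "odd_form A f2 f3 = 0" "odd_form A f2 f4 = 0" "odd_form A f3 f4 = 0"
    and nz: "left_op A f3 \<noteq> 0"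
  shows "A \<in> orbit J6"
proof -
  let ?L = "left_op A"
  note D = NJS_equationsD[OF A]
  have L2: "?L (?L v) = 0" for v using D(6)[of f1 f2 v] W(1) by simp
  obtain a b where L3: "?L f3 = a *s f3 + b *s f4" using left_op_in_radical[OF A fr W(1-5)] .
  have "b \<noteq> 0"
  proof
    assume b: "b = 0"
    then have "a *s ?L f3 = 0" using L2[of f3] L3 by (metis add.right_neutral left_op_linear(2) vec.scale_zero_left)
    then have "a = 0" using nz by (simp add: vec.scale_eq_0_iff)
    then show False using nz L3 b by simp
  qed
  have L4: "b *s ?L f4 = (- a) *s ?L f3"
  proof -
    have "?L (a *s f3 + b *s f4) = 0" using L2[of f3] L3 by simp
    then show ?thesis by (simp add: left_op_linear eq_neg_iff_add_eq_0 add.commute)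
  qed
  have shear: "\<exists>r. ?L v = r *s ?L f3" for v
  proof -
    obtain c d where Lv: "?L v = c *s f3 + d *s f4" using left_op_in_radical[OF A fr W(1-5)] .
    have "b *s ?L (?L v) = (b * c) *s ?L f3 + d *s (b *s ?L f4)"
      unfolding Lv by (simp add: left_op_linear vec_eq_iff algebra_simps)
    then have "(b * c - d * a) *s ?L f3 = 0" unfolding L4 L2 by (auto simp: vec_eq_iff algebra_simps)
    then have "b * c = d * a" using nz by (simp add: vec.scale_eq_0_iff)
    then have "?L v = (d / b) *s ?L f3"
      unfolding Lv L3 using \<open>b \<noteq> 0\<close> by (simp add: vec_eq_iff field_simps)
    then show ?thesis by blast
  qed
  obtain r s where r: "?L f1 = r *s ?L f3" and s: "?L f2 = s *s ?L f3" using shear by blast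
  have fr': "frame (?L f3) f3 (f1 - r *s f3) (f2 - s *s f3)"
    unfolding frame_def
  proof (intro allI impI)
    fix p q c d assume "p *s ?L f3 + q *s f3 + c *s (f1 - r *s f3) + d *s (f2 - s *s f3) = 0"
    then have "c *s f1 + d *s f2 + (p * a + q - c * r - d * s) *s f3 + (p * b) *s f4 = 0"
      unfolding L3 by (simp add: vec_eq_iff algebra_simps)
    from frameD[OF fr this] show "p = 0 \<and> q = 0 \<and> c = 0 \<and> d = 0" using \<open>b \<noteq> 0\<close> by auto
  qed
  have W': "odd_form A f3 f1 = 0" "odd_form A f3 f2 = 0" using D(2)[of f3 f1] D(2)[of f3 f2] W by simp_all
  show ?thesis
    by (rule orbit_J6I[OF fr'])
      (simp_all add: D(1,3,4,7) skew_odd_if_equations[OF A] L2 r s left_op_linear odd_form_bilinear W W')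
qed

text \<open>
  The plane spanned by \<open>f\<^sub>3\<close> and \<open>f\<^sub>4\<close> lies between the image and the kernel of \<open>L\<close> and in the radical of
  \<open>W\<close>; the numbers \<open>a, b, c, d\<close> form the matrix of the map induced by \<open>L\<close> from the quotient to this plane.
\<close>

definition J9_shape :: "(1, 4) sconst \<Rightarrow> complex^4 \<Rightarrow> complex^4 \<Rightarrow> complex^4 \<Rightarrow> complex^4 \<Rightarrow>
    complex \<Rightarrow> complex \<Rightarrow> complex \<Rightarrow> complex \<Rightarrow> complex \<Rightarrow> bool" where
  "J9_shape A f1 f2 f3 f4 a b c d s \<longleftrightarrow> frame f1 f2 f3 f4 \<and> even_square A = 0 \<and> skew_odd A \<and>
     left_op A f1 = a *s f3 + b *s f4 \<and> left_op A f2 = c *s f3 + d *s f4 \<and>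
     left_op A f3 = 0 \<and> left_op A f4 = 0 \<and>
     odd_form A f1 f2 = s \<and> odd_form A f1 f3 = 0 \<and> odd_form A f1 f4 = 0 \<and>
     odd_form A f2 f3 = 0 \<and> odd_form A f2 f4 = 0 \<and> odd_form A f3 f4 = 0"

text \<open>
  When \<open>L\<^sup>2 = 0\<close> there is a plane between the image and the kernel of \<open>L\<close>. It is found separately for
  rank 2, where it is the image, for rank 1, and for \<open>L = 0\<close>.
\<close>

lemma J9_shape_square_zero:
  assumes A: "NJS_equations A" and W: "\<And>u v. odd_form A u v = 0" and L2: "\<And>v. left_op A (left_op A v) = 0"
  shows "\<exists>f1 f2 f3 f4 a b c d s. J9_shape A f1 f2 f3 f4 a b c d s"
proof -
  let ?L = "left_op A"
  have c: "even_square A = 0" and sk: "skew_odd A"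
    using NJS_equationsD(1)[OF A] skew_odd_if_equations[OF A] by auto
  consider (two) x y where "\<And>a b. a *s ?L x + b *s ?L y = 0 \<Longrightarrow> a = 0 \<and> b = 0"
    | (zero) "\<And>x. ?L x = 0"
    | (one) x where "?L x \<noteq> 0" "\<And>y. \<exists>r. ?L y = r *s ?L x"
  proof -
    have "\<exists>r. ?L y = r *s ?L x" if x: "?L x \<noteq> 0" and dep: "a *s ?L x + b *s ?L y = 0" "\<not> (a = 0 \<and> b = 0)" for x y a b
    proof -
      have "b \<noteq> 0" using x dep by (auto simp: vec.scale_eq_0_iff)
      have "b * ?L y $ i = - (a * ?L x $ i)" for i
        using arg_cong[OF dep(1), of "\<lambda>v. v $ i"] by (simp add: add_eq_0_iff)
      then have "?L y = (- a / b) *s ?L x" using \<open>b \<noteq> 0\<close> by (simp add: vec_eq_iff field_simps)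
      then show ?thesis by blast
    qed
    then show ?thesis using that by metis
  qed
  then show ?thesis
  proof cases
    case (two x y)
    have "frame x y (?L x) (?L y)"
      unfolding frame_def
    proof (intro allI impI)
      fix a b c d assume eq: "a *s x + b *s y + c *s ?L x + d *s ?L y = 0"
      have "?L (a *s x + b *s y + c *s ?L x + d *s ?L y) = 0" by (simp only: eq left_op_linear)
      then have "a = 0 \<and> b = 0" by (intro two) (simp add: left_op_linear L2)
      then show "a = 0 \<and> b = 0 \<and> c = 0 \<and> d = 0" using eq two[of c d] by simp
    qed
    then have "J9_shape A x y (?L x) (?L y) 1 0 0 1 0" by (simp add: J9_shape_def c sk W L2)
    then show ?thesis by blast
  next
    case zero
    have "frame (axis 1 1) (axis 2 1) (axis 3 1) (axis 4 1)"
      by (simp add: frame_def vec_eq_iff forall_4 axis_def)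
    then have "J9_shape A (axis 1 1) (axis 2 1) (axis 3 1) (axis 4 1) 0 0 0 0 0"
      by (simp add: J9_shape_def c sk W zero)
    then show ?thesis by blast
  next
    case (one x)
    have "a = 0 \<and> b = 0" if eq: "a *s x + b *s ?L x = 0" for a b
    proof -
      have "?L (a *s x + b *s ?L x) = 0" by (simp only: eq left_op_linear)
      then have "a = 0" using one(1) by (simp add: left_op_linear L2 vec.scale_eq_0_iff)
      then show ?thesis using eq one(1) by (simp add: vec.scale_eq_0_iff)
    qed
    then obtain y z where fr: "frame x (?L x) y z" by (rule frame_extend2)
    obtain r q where r: "?L y = r *s ?L x" and q: "?L z = q *s ?L x" using one(2) by blast
    have "frame x (?L x) (y + (- r) *s x) (z + (- q) *s x)"
      using frame_shear[OF fr, of "- r" 0 "- q" 0 0] by simp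
    then have "frame x (z + (- q) *s x) (?L x) (y + (- r) *s x)"
      by (rule frame_permute(2))
    then have "J9_shape A x (z + (- q) *s x) (?L x) (y + (- r) *s x) 1 0 0 0 0"
      by (simp add: J9_shape_def c sk W L2 r q left_op_linear)
    then show ?thesis by blast
  qed
qed

lemma classification:
  assumes A: "NJS_equations A"
  shows "A \<in> orbit J3 \<or> A \<in> orbit J6 \<or> A \<in> orbit J7 \<or> (\<exists>f1 f2 f3 f4 a b c d s. J9_shape A f1 f2 f3 f4 a b c d s)"
proof -
  note D = NJS_equationsD[OF A]
  have sk: "skew_odd A" using A by (rule skew_odd_if_equations)
  show ?thesis
  proof (cases "\<forall>u v. odd_form A u v = 0")
    case True
    then show ?thesis using in_orbit_J7[OF A] J9_shape_square_zero[OF A] by metis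
  next
    case False
    then obtain u v where "odd_form A u v \<noteq> 0" by blast
    with sk obtain f1 f2 f3 f4 where fr: "frame f1 f2 f3 f4" and W: "odd_form A f1 f2 = 1" "odd_form A f1 f3 = 0"
      "odd_form A f1 f4 = 0" "odd_form A f2 f3 = 0" "odd_form A f2 f4 = 0" by (rule skew_frame)
    consider "odd_form A f3 f4 \<noteq> 0" | "odd_form A f3 f4 = 0" "left_op A f3 \<noteq> 0"
      | "odd_form A f3 f4 = 0" "left_op A f4 \<noteq> 0" | "odd_form A f3 f4 = 0" "left_op A f3 = 0" "left_op A f4 = 0"
      by blast
    then show ?thesis
    proof cases
      case 1 then show ?thesis using in_orbit_J3[OF A fr W] by blast
    next
      case 2 then show ?thesis using in_orbit_J6[OF A fr W] by blast
    next
      case 3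
      then have "odd_form A f4 f3 = 0" using D(2)[of f4 f3] by simp
      then show ?thesis using in_orbit_J6[OF A frame_permute(1)[OF fr] W(1,3,2,5,4)] 3 by blast
    next
      case 4
      obtain a b where "left_op A f1 = a *s f3 + b *s f4" using left_op_in_radical[OF A fr W] .
      moreover obtain c d where "left_op A f2 = c *s f3 + d *s f4" using left_op_in_radical[OF A fr W] .
      ultimately have "J9_shape A f1 f2 f3 f4 a b c d 1"
        using fr W 4 sk D(1) by (simp add: J9_shape_def)
      then show ?thesis by blast
    qed
  qed
qed

text \<open>
  The vectors \<open>L f\<^sub>1, L f\<^sub>2\<close> replace \<open>f\<^sub>3, f\<^sub>4\<close> as a basis of the plane, and dividing \<open>f\<^sub>1\<close> by \<open>s\<close>
  normalizes the form.
\<close>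

lemma J9_shape_in_orbit:
  assumes A: "J9_shape A f1 f2 f3 f4 a b c d s" and det: "a * d - b * c \<noteq> 0" and s: "s \<noteq> 0"
  shows "A \<in> orbit J9"
proof -
  note * = A[unfolded J9_shape_def]
  have fr: "frame f1 f2 f3 f4" using * by blast
  have diag: "odd_form A u u = 0" for u using skew_oddD[of A u u] * by simp
  have W': "odd_form A f3 f1 = 0" "odd_form A f4 f1 = 0" "odd_form A f3 f2 = 0" "odd_form A f4 f2 = 0" "odd_form A f4 f3 = 0"
    using skew_oddD[of A f3 f1] skew_oddD[of A f4 f1] skew_oddD[of A f3 f2] skew_oddD[of A f4 f2] skew_oddD[of A f4 f3] *
    by simp_all
  have "frame (inverse s *s left_op A f1) (inverse s *s f1) (left_op A f2) f2"
    unfolding frame_def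
  proof (intro allI impI)
    fix p q r t assume "p *s (inverse s *s left_op A f1) + q *s (inverse s *s f1) + r *s left_op A f2 + t *s f2 = 0"
    then have "(q * inverse s) *s f1 + t *s f2 + (p * inverse s * a + r * c) *s f3 + (p * inverse s * b + r * d) *s f4 = 0"
      using * by (simp add: vec_eq_iff algebra_simps)
    from frameD[OF fr this] have q: "q = 0" "t = 0" and e: "p * inverse s * a + r * c = 0" "p * inverse s * b + r * d = 0"
      using s by auto
    have "(p * inverse s) * (a * d - b * c) = (p * inverse s * a + r * c) * d - (p * inverse s * b + r * d) * c"
      "r * (a * d - b * c) = (p * inverse s * b + r * d) * a - (p * inverse s * a + r * c) * b"
      by (simp_all add: algebra_simps)
    then have "(p * inverse s) * (a * d - b * c) = 0" "r * (a * d - b * c) = 0" unfolding e by simp_all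
    then show "p = 0 \<and> q = 0 \<and> r = 0 \<and> t = 0" using q det s by simp
  qed
  then show ?thesis
    by (rule orbit_J9I) (use * s in \<open>simp_all add: left_op_linear odd_form_bilinear diag W'\<close>)
qed

lemma basis_change_1n:
  fixes A :: "(1, 'n::finite) sconst"
  assumes Q: "invertible Q"
  shows "left_op (basis_change (mat 1) Q A) (Q *v u) = Q *v left_op A u"
    and "odd_form (basis_change (mat 1) Q A) (Q *v u) (Q *v v) = odd_form A u v"
proof -
  let ?C = "basis_change (mat 1) Q A"
  have I: "invertible (mat 1 :: complex^1^1)" by (simp add: invertible_det_nz)
  have b: "block_map (mat 1) Q (gvec a u) = gvec a (Q *v u)" for a u
    by (simp add: block_map_gvec mat_def)
  have m: "mult_of ?C (block_map (mat 1) Q x) (block_map (mat 1) Q y) = block_map (mat 1) Q (mult_of A x y)" for x y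
    by (simp add: mult_of_basis_change[OF I Q] block_map_inverse[OF I Q])
  show "left_op ?C (Q *v u) = Q *v left_op A u"
    using m[of "gvec 1 0" "gvec 0 u"] by (simp add: b mult_of_gvec odd_form_bilinear)
  show "odd_form ?C (Q *v u) (Q *v v) = odd_form A u v"
    using m[of "gvec 0 u" "gvec 0 v"] by (simp add: b mult_of_gvec)
qed

lemma sconst_line:
  "even_square (A + t *s C) = even_square A + t * even_square C"
  "left_op (A + t *s C) u = left_op A u + t *s left_op C u"
  "odd_form (A + t *s C) u v = odd_form A u v + t * odd_form C u v"
  by (simp_all add: even_square_def left_op_def odd_form_def vec_eq_iff algebra_simps sum.distrib sum_distrib_left)

text \<open>
  Let \<open>C\<close> be the copy of \<open>J9\<close> adapted to the same basis. On the line \<open>A + t C\<close> the matrix becomes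
  itself plus \<open>t\<close> times the identity and \<open>s\<close> becomes \<open>s + t\<close>, so all but finitely many points of this
  line lie in the orbit of \<open>J9\<close>.
\<close>

lemma J9_shape_in_closure:
  assumes A: "J9_shape A f1 f2 f3 f4 a b c d s"
  shows "A \<in> zariski closure_of orbit J9"
proof -
  note * = A[unfolded J9_shape_def]
  let ?Q = "columns4 f3 f1 f4 f2"
  have fr: "frame f1 f2 f3 f4" using * by blast
  have Q: "invertible ?Q" by (rule invertible_columns4[OF frame_permute(3)[OF fr]])
  define C where "C = basis_change (mat 1) ?Q J9"
  have "C \<in> orbit J9"
  proof -
    have "invertible (mat 1 :: complex^1^1)" by (simp add: invertible_det_nz)
    then show ?thesis unfolding orbit_def C_def using Q by blast
  qed
  then have NC: "NJS_equations C" using NJS_orbit J_in_NJS(4) NJS_iff_equations by blast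
  (* J9 sends its second and fourth basis vectors to the first and third one and pairs them to 1. *)
  have f: "?Q *v axis 1 1 = f3" "?Q *v axis 2 1 = f1" "?Q *v axis 3 1 = f4" "?Q *v axis 4 1 = f2"
    by (simp_all add: columns4_mult axis_def)
  have L: "left_op C f1 = f3" "left_op C f2 = f4" "left_op C f3 = 0" "left_op C f4 = 0"
    using basis_change_1n(1)[OF Q, of J9 "axis 2 1"] basis_change_1n(1)[OF Q, of J9 "axis 4 1"]
      basis_change_1n(1)[OF Q, of J9 "axis 1 1"] basis_change_1n(1)[OF Q, of J9 "axis 3 1"]
    by (simp_all add: f C_def left_op_J) (simp_all add: axis_def columns4_mult)
  have W: "odd_form C f1 f2 = 1" "odd_form C f1 f3 = 0" "odd_form C f1 f4 = 0" "odd_form C f2 f3 = 0"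
      "odd_form C f2 f4 = 0" "odd_form C f3 f4 = 0"
    using basis_change_1n(2)[OF Q, of J9 "axis 2 1" "axis 4 1"] basis_change_1n(2)[OF Q, of J9 "axis 2 1" "axis 1 1"]
      basis_change_1n(2)[OF Q, of J9 "axis 2 1" "axis 3 1"] basis_change_1n(2)[OF Q, of J9 "axis 4 1" "axis 1 1"]
      basis_change_1n(2)[OF Q, of J9 "axis 4 1" "axis 3 1"] basis_change_1n(2)[OF Q, of J9 "axis 1 1" "axis 3 1"]
    by (simp_all add: f C_def odd_form_J) (simp_all add: axis_def)
  have shape: "J9_shape (A + t *s C) f1 f2 f3 f4 (a + t) b c (d + t) (s + t)" for t
  proof -
    have "skew_odd (A + t *s C)"
      unfolding skew_odd_def
    proof (intro allI)
      fix u v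
      show "odd_form (A + t *s C) u v + odd_form (A + t *s C) v u = 0"
        using skew_oddD[of A u v] NJS_equationsD(2)[OF NC, of u v] * by (simp add: sconst_line)
    qed
    then show ?thesis
      using * unfolding J9_shape_def
      by (simp add: sconst_line L W NJS_equationsD(1)[OF NC] vec_eq_iff algebra_simps)
  qed
  (* The determinant of the shifted matrix times the shifted scalar is a monic cubic in t. *)
  define \<delta> where "\<delta> t = ((a + t) * (d + t) - b * c) * (s + t)" for t
  have "\<delta> = poly ([:a * d - b * c, a + d, 1:] * [:s, 1:])"
    by (rule ext) (simp add: \<delta>_def algebra_simps)
  moreover have "[:a * d - b * c, a + d, 1:] * [:s, 1:] \<noteq> 0" by simp
  ultimately obtain z where z: "\<delta> z \<noteq> 0" using poly_all_0_iff_0 by metis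
  moreover have "rational_on UNIV \<delta>"
    unfolding rational_on_def \<open>\<delta> = _\<close> by (intro exI[of _ "[:a * d - b * c, a + d, 1:] * [:s, 1:]"] exI[of _ 1]) simp
  moreover have "A + t *s C \<in> orbit J9" if "\<delta> t \<noteq> 0" for t
    using J9_shape_in_orbit[OF shape[of t]] that by (simp add: \<delta>_def)
  ultimately show ?thesis by (intro in_zariski_closure_along_line)
qed

section \<open>The four open orbits\<close>

text \<open>
  For alternating \<open>W\<close> this is \<open>W \<and> W \<noteq> 0\<close>, that is, nondegeneracy in dimension 4.
\<close>

definition plucker_nonzero :: "(1, 4) sconst \<Rightarrow> bool" where
  "plucker_nonzero A \<longleftrightarrow> (\<exists>x y z w. odd_form A x y * odd_form A z w - odd_form A x z * odd_form A y w
     + odd_form A x w * odd_form A y z \<noteq> 0)"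

text \<open>
  For alternating \<open>W\<close> the expression is the vector-valued 3-form \<open>W \<and> L\<close>. For
  \<open>L = \<phi> u\<close> of rank 1 it is \<open>(W \<and> \<phi>) u\<close>, which is nonzero exactly when \<open>W\<close> does not vanish on the kernel
  of \<open>L\<close>; this separates \<open>J6\<close> from the degenerations of \<open>J9\<close>.
\<close>

definition wedge_nonzero :: "(1, 4) sconst \<Rightarrow> bool" where
  "wedge_nonzero A \<longleftrightarrow> (\<exists>x y z. odd_form A x y *s left_op A z - odd_form A x z *s left_op A y
     + odd_form A y z *s left_op A x \<noteq> 0)"

definition square_nonzero :: "(1, 4) sconst \<Rightarrow> bool" where
  "square_nonzero A \<longleftrightarrow> (\<exists>x. left_op A (left_op A x) \<noteq> 0)"

definition form_and_rank2 :: "(1, 4) sconst \<Rightarrow> bool" where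
  "form_and_rank2 A \<longleftrightarrow> (\<exists>x y z w. odd_form A x y \<noteq> 0 \<and>
     (\<forall>a b. a *s left_op A z + b *s left_op A w = 0 \<longrightarrow> a = 0 \<and> b = 0))"

text \<open>
  Independence is convenient for invariance under change of basis; the minors show that it is an
  open condition.
\<close>

lemma independent_pair_iff_minor:
  fixes u v :: "complex^'n"
  shows "(\<forall>a b. a *s u + b *s v = 0 \<longrightarrow> a = 0 \<and> b = 0) \<longleftrightarrow> (\<exists>k l. u $ k * v $ l - u $ l * v $ k \<noteq> 0)"
    (is "?ind \<longleftrightarrow> ?minor")
proof
  assume ind: ?ind
  show ?minor
  proof (rule ccontr)
    assume "\<not> ?minor"
    then have m: "u $ k * v $ l = u $ l * v $ k" for k l by simp
    have "u $ k = 0" for k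
    proof -
      have "(- v $ k) *s u + u $ k *s v = 0" by (simp add: vec_eq_iff m mult.commute)
      then show ?thesis using ind by blast
    qed
    then have "1 *s u + 0 *s v = 0" by (simp add: vec_eq_iff)
    from ind[rule_format, OF this] show False by simp
  qed
next
  assume ?minor
  then obtain k l where kl: "u $ k * v $ l - u $ l * v $ k \<noteq> 0" by blast
  show ?ind
  proof (intro allI impI)
    fix a b assume "a *s u + b *s v = 0"
    then have e: "a * u $ i + b * v $ i = 0" for i by (metis vector_add_component vector_smult_component zero_index)
    have "a * (u $ k * v $ l - u $ l * v $ k) = (a * u $ k + b * v $ k) * v $ l - (a * u $ l + b * v $ l) * v $ k"
      "b * (u $ k * v $ l - u $ l * v $ k) = (a * u $ l + b * v $ l) * u $ k - (a * u $ k + b * v $ k) * u $ l"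
      by (simp_all add: algebra_simps)
    then show "a = 0 \<and> b = 0" unfolding e using kl by simp
  qed
qed

lemma form_and_rank2_iff_minor:
  "form_and_rank2 A \<longleftrightarrow> (\<exists>x y z w k l. odd_form A x y *
     (left_op A z $ k * left_op A w $ l - left_op A z $ l * left_op A w $ k) \<noteq> 0)"
  unfolding form_and_rank2_def independent_pair_iff_minor mult_eq_0_iff de_Morgan_disj by blast

lemma closedin_negated_conditions:
  "closedin zariski {A. \<not> plucker_nonzero A}" "closedin zariski {A. \<not> wedge_nonzero A}"
  "closedin zariski {A. \<not> square_nonzero A}" "closedin zariski {A. \<not> form_and_rank2 A}"
  unfolding plucker_nonzero_def wedge_nonzero_def square_nonzero_def form_and_rank2_iff_minor not_ex not_not
    vec_eq_iff vector_smult_component vector_add_component vector_minus_component zero_index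
  by (intro closedin_zariski_all closedin_zariski_zeros poly_functions_intros)+

lemma conditions_orbit:
  assumes "B \<in> orbit A"
  shows "plucker_nonzero A \<Longrightarrow> plucker_nonzero B" "wedge_nonzero A \<Longrightarrow> wedge_nonzero B"
    "square_nonzero A \<Longrightarrow> square_nonzero B" "form_and_rank2 A \<Longrightarrow> form_and_rank2 B"
proof -
  obtain p Q where p: "p \<noteq> 0" and Q: "invertible Q"
    and L: "\<And>u. Q *v left_op A u = p *s left_op B (Q *v u)"
    and W: "\<And>u v. p * odd_form A u v = odd_form B (Q *v u) (Q *v v)"
    using orbitE_1n[OF assms] by metis
  have inj: "Q *v u = 0 \<longleftrightarrow> u = 0" for u
    using Q unfolding invertible_left_inverse matrix_left_invertible_ker by auto
  have LB: "left_op B (Q *v u) = Q *v (inverse p *s left_op A u)" for u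
    by (simp add: vector_scalar_commute L p)
  {
    assume "plucker_nonzero A"
    then obtain x y z w where *: "odd_form A x y * odd_form A z w - odd_form A x z * odd_form A y w
     + odd_form A x w * odd_form A y z \<noteq> 0" unfolding plucker_nonzero_def by blast
    have "odd_form B (Q *v x) (Q *v y) * odd_form B (Q *v z) (Q *v w)
        - odd_form B (Q *v x) (Q *v z) * odd_form B (Q *v y) (Q *v w)
        + odd_form B (Q *v x) (Q *v w) * odd_form B (Q *v y) (Q *v z)
      = p * p * (odd_form A x y * odd_form A z w - odd_form A x z * odd_form A y w + odd_form A x w * odd_form A y z)"
      unfolding W[symmetric] by (simp add: algebra_simps)
    also have "\<dots> \<noteq> 0" using * p by simp
    finally show "plucker_nonzero B" unfolding plucker_nonzero_def by blast
  next
    assume "wedge_nonzero A"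
    then obtain x y z where *: "odd_form A x y *s left_op A z - odd_form A x z *s left_op A y
     + odd_form A y z *s left_op A x \<noteq> 0" unfolding wedge_nonzero_def by blast
    have "odd_form B (Q *v x) (Q *v y) *s left_op B (Q *v z) - odd_form B (Q *v x) (Q *v z) *s left_op B (Q *v y)
        + odd_form B (Q *v y) (Q *v z) *s left_op B (Q *v x)
      = Q *v (odd_form A x y *s left_op A z - odd_form A x z *s left_op A y + odd_form A y z *s left_op A x)"
    proof -
      have scale: "p * r * inverse p = r" for r using p by simp
      show ?thesis
        unfolding W[symmetric] LB
        by (simp add: scale vector_scalar_commute matrix_vector_right_distrib matrix_vector_mult_diff_distrib)
    qed
    also have "\<dots> \<noteq> 0" using * by (simp add: inj)
    finally show "wedge_nonzero B" unfolding wedge_nonzero_def by blast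
  next
    assume "square_nonzero A"
    then obtain x where *: "left_op A (left_op A x) \<noteq> 0" unfolding square_nonzero_def by blast
    have "left_op B (left_op B (Q *v x)) = Q *v (inverse p *s (inverse p *s left_op A (left_op A x)))"
      by (simp only: LB left_op_linear)
    also have "\<dots> \<noteq> 0" using * p by (simp add: inj vec.scale_eq_0_iff)
    finally show "square_nonzero B" unfolding square_nonzero_def by blast
  next
    assume "form_and_rank2 A"
    then obtain x y z w where *: "odd_form A x y \<noteq> 0"
      "\<And>a b. a *s left_op A z + b *s left_op A w = 0 \<Longrightarrow> a = 0 \<and> b = 0" unfolding form_and_rank2_def by blast
    have "odd_form B (Q *v x) (Q *v y) \<noteq> 0" using * p by (simp flip: W)
    moreover have "a = 0 \<and> b = 0" if "a *s left_op B (Q *v z) + b *s left_op B (Q *v w) = 0" for a b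
    proof -
      have "a *s left_op B (Q *v z) + b *s left_op B (Q *v w)
          = Q *v (inverse p *s (a *s left_op A z + b *s left_op A w))"
        unfolding LB by (simp add: vector_scalar_commute matrix_vector_right_distrib vec.scale_right_distrib mult.commute)
      then have "inverse p *s (a *s left_op A z + b *s left_op A w) = 0" using inj that by metis
      then have "a *s left_op A z + b *s left_op A w = 0" using p by (simp only: vec.scale_eq_0_iff) simp
      then show ?thesis by (rule *(2))
    qed
    ultimately show "form_and_rank2 B" unfolding form_and_rank2_def by blast
  }
qed

lemma conditions_J:
  "plucker_nonzero J3" "\<not> wedge_nonzero J3" "\<not> square_nonzero J3" "\<not> form_and_rank2 J3"
  "\<not> plucker_nonzero J6" "wedge_nonzero J6" "\<not> square_nonzero J6" "\<not> form_and_rank2 J6"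
  "\<not> plucker_nonzero J7" "\<not> wedge_nonzero J7" "square_nonzero J7" "\<not> form_and_rank2 J7"
  "\<not> plucker_nonzero J9" "\<not> wedge_nonzero J9" "\<not> square_nonzero J9" "form_and_rank2 J9"
proof -
  show "plucker_nonzero J3"
    unfolding plucker_nonzero_def odd_form_J
    by (rule exI[of _ "axis 1 1"], rule exI[of _ "axis 2 1"], rule exI[of _ "axis 3 1"], rule exI[of _ "axis 4 1"])
      (simp add: axis_def)
  show "wedge_nonzero J6"
    unfolding wedge_nonzero_def odd_form_J left_op_J
    by (rule exI[of _ "axis 3 1"], rule exI[of _ "axis 4 1"], rule exI[of _ "axis 2 1"])
      (simp add: axis_def vec_eq_iff)
  show "square_nonzero J7"
    unfolding square_nonzero_def left_op_J
    by (rule exI[of _ "axis 3 1"]) (simp add: axis_def vec_eq_iff)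
  show "form_and_rank2 J9"
    unfolding form_and_rank2_iff_minor left_op_J odd_form_J
    by (rule exI[of _ "axis 2 1"], rule exI[of _ "axis 4 1"], rule exI[of _ "axis 2 1"], rule exI[of _ "axis 4 1"],
        rule exI[of _ 1], rule exI[of _ 3]) (simp add: axis_def)
  show "\<not> wedge_nonzero J3" "\<not> square_nonzero J3" "\<not> form_and_rank2 J3"
    "\<not> plucker_nonzero J6" "\<not> square_nonzero J6" "\<not> form_and_rank2 J6"
    "\<not> plucker_nonzero J7" "\<not> wedge_nonzero J7" "\<not> form_and_rank2 J7"
    "\<not> plucker_nonzero J9" "\<not> wedge_nonzero J9" "\<not> square_nonzero J9"
    by (simp_all add: plucker_nonzero_def wedge_nonzero_def square_nonzero_def form_and_rank2_iff_minor
        odd_form_J left_op_J axis_def vec_eq_iff algebra_simps)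
qed

lemma J9_shape_form_and_rank2:
  assumes A: "J9_shape A f1 f2 f3 f4 a b c d s" and *: "form_and_rank2 A"
  shows "A \<in> orbit J9"
proof (rule J9_shape_in_orbit[OF A])
  note sh = A[unfolded J9_shape_def]
  have fr: "frame f1 f2 f3 f4" using sh by blast
  obtain x y z w k l where xy: "odd_form A x y \<noteq> 0"
    and zw: "left_op A z $ k * left_op A w $ l - left_op A z $ l * left_op A w $ k \<noteq> 0"
    using * unfolding form_and_rank2_iff_minor by auto
  obtain x1 x2 x3 x4 where x: "x = x1 *s f1 + x2 *s f2 + x3 *s f3 + x4 *s f4" using fr by (rule frame_spans)
  obtain y1 y2 y3 y4 where y: "y = y1 *s f1 + y2 *s f2 + y3 *s f3 + y4 *s f4" using fr by (rule frame_spans)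
  obtain z1 z2 z3 z4 where z: "z = z1 *s f1 + z2 *s f2 + z3 *s f3 + z4 *s f4" using fr by (rule frame_spans)
  obtain w1 w2 w3 w4 where w: "w = w1 *s f1 + w2 *s f2 + w3 *s f3 + w4 *s f4" using fr by (rule frame_spans)
  have "odd_form A x y = (x1 * y2 - x2 * y1) * s"
    using sh unfolding x y by (simp add: odd_form_frame)
  then show "s \<noteq> 0" using xy by auto
  have "left_op A z $ k * left_op A w $ l - left_op A z $ l * left_op A w $ k =
      (z1 * w2 - z2 * w1) * (a * d - b * c) * (f3 $ k * f4 $ l - f3 $ l * f4 $ k)"
    using sh unfolding z w by (simp add: left_op_linear algebra_simps)
  then show "a * d - b * c \<noteq> 0" using zw by auto
qed

lemma NJS_cover:
  assumes "A \<in> NJS"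
  shows "A \<in> orbit J3 \<or> A \<in> orbit J6 \<or> A \<in> orbit J7 \<or>
    (A \<in> zariski closure_of orbit J9 \<and> (form_and_rank2 A \<longrightarrow> A \<in> orbit J9))"
proof -
  have "NJS_equations A" using assms by (simp add: NJS_iff_equations)
  from classification[OF this] show ?thesis
    using J9_shape_in_closure J9_shape_form_and_rank2 by blast
qed

text \<open>
  For \<open>J3\<close>, \<open>J6\<close> and \<open>J7\<close> the condition excludes the other alternatives of the classification. The
  algebras in the closure of the orbit of \<open>J9\<close> are excluded because the negated condition is closed and
  holds at \<open>J9\<close>. For \<open>J9\<close> the condition makes the matrix and the scalar of the normal form invertible.
\<close>

lemma orbit_eq_condition:
  "orbit J3 = {A \<in> NJS. plucker_nonzero A}" "orbit J6 = {A \<in> NJS. wedge_nonzero A}"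
  "orbit J7 = {A \<in> NJS. square_nonzero A}" "orbit J9 = {A \<in> NJS. form_and_rank2 A}"
proof -
  have sym: "J \<in> orbit A" if "A \<in> orbit J" for A J :: "(1, 4) sconst"
    using that orbit_eq_iff self_in_orbit by metis
  have neg: "A \<in> orbit J \<Longrightarrow> \<not> plucker_nonzero J \<Longrightarrow> \<not> plucker_nonzero A"
    "A \<in> orbit J \<Longrightarrow> \<not> wedge_nonzero J \<Longrightarrow> \<not> wedge_nonzero A"
    "A \<in> orbit J \<Longrightarrow> \<not> square_nonzero J \<Longrightarrow> \<not> square_nonzero A"
    "A \<in> orbit J \<Longrightarrow> \<not> form_and_rank2 J \<Longrightarrow> \<not> form_and_rank2 A" for A J
    using conditions_orbit[OF sym] by blast+
  have "zariski closure_of orbit J9 \<subseteq> {A. \<not> plucker_nonzero A}" "zariski closure_of orbit J9 \<subseteq> {A. \<not> wedge_nonzero A}"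
    "zariski closure_of orbit J9 \<subseteq> {A. \<not> square_nonzero A}"
    by (intro closure_of_minimal closedin_negated_conditions subsetI CollectI; use neg conditions_J in blast)+
  then have cl: "A \<in> zariski closure_of orbit J9 \<Longrightarrow> \<not> plucker_nonzero A \<and> \<not> wedge_nonzero A \<and> \<not> square_nonzero A" for A
    by blast
  have sub: "A \<in> orbit J \<Longrightarrow> J \<in> NJS \<Longrightarrow> A \<in> NJS" for A J :: "(1, 4) sconst" by (rule NJS_orbit)
  show "orbit J3 = {A \<in> NJS. plucker_nonzero A}"
  proof (intro set_eqI iffI)
    fix A assume "A \<in> {A \<in> NJS. plucker_nonzero A}"
    then show "A \<in> orbit J3" using NJS_cover[of A] neg(1)[of A] conditions_J cl[of A] by blast
  qed (use sub J_in_NJS conditions_orbit conditions_J in blast)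
  show "orbit J6 = {A \<in> NJS. wedge_nonzero A}"
  proof (intro set_eqI iffI)
    fix A assume "A \<in> {A \<in> NJS. wedge_nonzero A}"
    then show "A \<in> orbit J6" using NJS_cover[of A] neg(2)[of A] conditions_J cl[of A] by blast
  qed (use sub J_in_NJS conditions_orbit conditions_J in blast)
  show "orbit J7 = {A \<in> NJS. square_nonzero A}"
  proof (intro set_eqI iffI)
    fix A assume "A \<in> {A \<in> NJS. square_nonzero A}"
    then show "A \<in> orbit J7" using NJS_cover[of A] neg(3)[of A] conditions_J cl[of A] by blast
  qed (use sub J_in_NJS conditions_orbit conditions_J in blast)
  show "orbit J9 = {A \<in> NJS. form_and_rank2 A}"
  proof (intro set_eqI iffI)
    fix A assume "A \<in> {A \<in> NJS. form_and_rank2 A}"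
    then show "A \<in> orbit J9" using NJS_cover[of A] neg(4)[of A] conditions_J by blast
  qed (use sub J_in_NJS conditions_orbit conditions_J in blast)
qed

lemma openin_orbit_J:
  "J \<in> {J3, J6, J7, J9} \<Longrightarrow> openin (subtopology zariski NJS) (orbit J)"
proof -
  have "openin (subtopology zariski NJS) {A \<in> NJS. P A}"
    if "closedin zariski {A. \<not> P A}" for P :: "(1, 4) sconst \<Rightarrow> bool"
  proof -
    have "openin zariski (- {A. \<not> P A})" using that by (simp add: closedin_def Compl_eq_Diff_UNIV)
    moreover have "{A \<in> NJS. P A} = - {A. \<not> P A} \<inter> NJS" by auto
    ultimately show ?thesis unfolding openin_subtopology by blast
  qed
  then show "J \<in> {J3, J6, J7, J9} \<Longrightarrow> openin (subtopology zariski NJS) (orbit J)"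
    using closedin_negated_conditions by (auto simp: orbit_eq_condition)
qed

lemma orbit_J_distinct:
  assumes "J \<in> {J3, J6, J7, J9}" "K \<in> {J3, J6, J7, J9}" "orbit J \<inter> orbit K \<noteq> {}"
  shows "J = K"
proof -
  have "K \<in> orbit J" using assms(3) orbit_eq_iff self_in_orbit by (metis disjoint_iff)
  then show ?thesis using assms(1,2) conditions_orbit conditions_J by blast
qed

theorem theorem4p2:
  shows "{J3, J6, J7, J9} \<subseteq> NJS \<and>
         irreducible_components (subtopology zariski (NJS :: (1, 4) sconst set)) =
           {zariski closure_of orbit J3, zariski closure_of orbit J6,
            zariski closure_of orbit J7, zariski closure_of orbit J9} \<and>
         card (irreducible_components (subtopology zariski (NJS :: (1, 4) sconst set))) = 4 \<and>
         (\<forall>A \<in> (NJS :: (1, 4) sconst set).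
            rigid A \<longleftrightarrow> (\<exists>B \<in> {J3, J6, J7, J9}. superalgebra_iso (mult_of A) (mult_of B)))"
proof -
  let ?J = "{J3, J6, J7, J9}" and ?X = "subtopology zariski (NJS :: (1, 4) sconst set)"
  have J: "?J \<subseteq> NJS" using J_in_NJS by simp
  have sub: "orbit B \<subseteq> NJS" if "B \<in> ?J" for B
    using NJS_orbit J that by blast
  have cl: "?X closure_of orbit B = zariski closure_of orbit B" if "B \<in> ?J" for B
  proof -
    have "zariski closure_of orbit B \<subseteq> NJS"
      using sub[OF that] closedin_NJS by (rule closure_of_minimal)
    moreover have "NJS \<inter> orbit B = orbit B" using sub[OF that] by blast
    ultimately show ?thesis unfolding closure_of_subtopology by auto
  qed
  have cover: "\<exists>B\<in>?J. A \<in> zariski closure_of orbit B" if "A \<in> NJS" for A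
  proof -
    have "orbit B \<subseteq> zariski closure_of orbit B" for B :: "(1, 4) sconst" by (rule closure_of_subset) simp
    then show ?thesis using NJS_cover[OF that] by blast
  qed
  have inj: "inj_on orbit ?J"
    using orbit_J_distinct self_in_orbit by (intro inj_onI) blast
  have op: "openin ?X U" if "U \<in> orbit ` ?J" for U
    using that openin_orbit_J by (elim imageE) simp
  have irr: "irreducible_space (subtopology ?X U)" if U: "U \<in> orbit ` ?J" for U
  proof -
    obtain B where "U = orbit B" "B \<in> ?J" using U by blast
    then show ?thesis
      using irreducible_orbit[of B] sub by (simp add: subtopology_subtopology inf.absorb2)
  qed
  have disj: "U \<inter> V = {}" if U: "U \<in> orbit ` ?J" and V: "V \<in> orbit ` ?J" and ne: "U \<noteq> V" for U V
  proof -
    obtain B where B: "U = orbit B" "B \<in> ?J" using U by blast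
    obtain C where C: "V = orbit C" "C \<in> ?J" using V by blast
    show ?thesis
      using orbit_J_distinct[OF B(2) C(2)] ne unfolding B(1) C(1)
      by (cases "orbit B \<inter> orbit C = {}") simp_all
  qed
  have top: "topspace ?X \<subseteq> (\<Union>U\<in>orbit ` ?J. ?X closure_of U)"
  proof
    fix A assume "A \<in> topspace ?X"
    then obtain B where "B \<in> ?J" "A \<in> zariski closure_of orbit B" using cover[of A] by auto
    then show "A \<in> (\<Union>U\<in>orbit ` ?J. ?X closure_of U)" using cl by blast
  qed
  have fin: "finite (orbit ` ?J)" by simp
  have comp: "irreducible_components ?X = (\<lambda>U. ?X closure_of U) ` orbit ` ?J"
    by (rule irreducible_components_eq_closures(1)) (fact fin op irr disj top)+
  have inj_cl: "inj_on (\<lambda>U. ?X closure_of U) (orbit ` ?J)"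
    by (rule irreducible_components_eq_closures(2)) (fact fin op irr disj top)+
  have "irreducible_components ?X = (\<lambda>B. zariski closure_of orbit B) ` ?J"
    unfolding comp image_image by (rule image_cong[OF refl cl])
  moreover have "card (irreducible_components ?X) = 4"
  proof -
    have "card (irreducible_components ?X) = card ?J"
      unfolding comp by (simp only: card_image[OF inj_cl] card_image[OF inj])
    moreover have "distinct [J3, J6, J7, J9]" using conditions_J by (auto simp: distinct_def)
    then have "card ?J = 4" using distinct_card[of "[J3, J6, J7, J9]"] by simp
    ultimately show ?thesis by simp
  qed
  moreover have "rigid A \<longleftrightarrow> (\<exists>B\<in>?J. superalgebra_iso (mult_of A) (mult_of B))" if A: "A \<in> NJS" for A
  proof
    assume "rigid A"
    then have op: "openin ?X (orbit A)" by (simp add: rigid_def)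
    obtain B where B: "B \<in> ?J" "A \<in> ?X closure_of orbit B" using cover[OF A] cl by blast
    then obtain C where "C \<in> orbit B" "C \<in> orbit A"
      using op self_in_orbit[of A] unfolding in_closure_of by blast
    then have "B \<in> orbit A" using orbit_eq_iff self_in_orbit by metis
    then show "\<exists>B\<in>?J. superalgebra_iso (mult_of A) (mult_of B)" using B(1) orbit_iff_iso by blast
  next
    assume "\<exists>B\<in>?J. superalgebra_iso (mult_of A) (mult_of B)"
    then obtain B where "B \<in> ?J" "B \<in> orbit A" using orbit_iff_iso by blast
    then have "openin ?X (orbit A)" using openin_orbit_J[of B] orbit_eq_iff[of A B] by simp
    then show "rigid A" using A by (simp add: rigid_def)
  qed
  ultimately show ?thesis using J by simp
qed

end
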